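(* For any $\theta<2$ and $t_0>0$ the process $$\exp\Big(\frac{\theta M_t}{A_t}\Big)$$ is a supermartingale for $t\ge t_0$. In particular, $$E\Big[\exp\Big(\frac{\theta M_t}{A_t}\Big)\Big]<\infty,$$ and the expected value is a strictly decreasing function of $t$.
   Context: $(B_t)_{t\ge 0}$ is a standard one-dimensional Brownian motion started at $0$, $M_t=\exp(B_t-t/2)$, and $A_t=\int_0^t M_s\,ds$. The supermartingale property is with respect to the filtration of the Brownian motion.
   Formalization: The supermartingale property is stated for 0 ≤ θ < 2 and strict decrease for 0 < θ < 2 (finiteness for all θ < 2): at θ = 0 the process is constant, and for θ < 0 its expected value strictly increases, so these claims fail there. *)

theory Defs
  imports "HOL-Probability.Probability"
begin

text \<open>Time is real-valued and only the times \<open>t \<ge> 0\<close> matter; the values of \<open>B\<close> at negative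
  times are unconstrained. Continuity is required of every path, so that the path integrals
  below are adapted to the uncompleted natural filtration.\<close>

locale brownian_motion = prob_space M for M :: "'a measure" +
  fixes B :: "real \<Rightarrow> 'a \<Rightarrow> real"
  assumes random_variable_B: "t \<ge> 0 \<Longrightarrow> random_variable borel (B t)"
    and start: "AE \<omega> in M. B 0 \<omega> = 0"
    and continuous_paths: "\<omega> \<in> space M \<Longrightarrow> continuous_on {0..} (\<lambda>t. B t \<omega>)"
    and gaussian_increments: "0 \<le> s \<Longrightarrow> s < t \<Longrightarrow>
      distributed M lborel (\<lambda>\<omega>. B t \<omega> - B s \<omega>) (\<lambda>x. ennreal (normal_density 0 (sqrt (t - s)) x))"
    and independent_increments: "\<And>(n :: nat) (\<tau> :: nat \<Rightarrow> real).
      0 \<le> \<tau> 0 \<Longrightarrow> (\<And>i. i < n \<Longrightarrow> \<tau> i < \<tau> (Suc i)) \<Longrightarrow>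
      indep_vars (\<lambda>_. borel) (\<lambda>i \<omega>. B (\<tau> (Suc i)) \<omega> - B (\<tau> i) \<omega>) {..<n}"

definition natural_filtration :: "'a measure \<Rightarrow> (real \<Rightarrow> 'a \<Rightarrow> real) \<Rightarrow> real \<Rightarrow> 'a measure" where
  "natural_filtration M B t =
     sigma (space M) {B s -` U \<inter> space M | s U. 0 \<le> s \<and> s \<le> t \<and> U \<in> sets borel}"

locale supermartingale = prob_space M + filtration "space M" F
  for M :: "'a measure" and F :: "real \<Rightarrow> 'a measure" +
  fixes T :: "real set" and X :: "real \<Rightarrow> 'a \<Rightarrow> real"
  assumes subalgebra_F: "t \<in> T \<Longrightarrow> subalgebra M (F t)"
    and adapted: "t \<in> T \<Longrightarrow> X t \<in> borel_measurable (F t)"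
    and integrable_X: "t \<in> T \<Longrightarrow> integrable M (X t)"
    and cond_exp_le: "s \<in> T \<Longrightarrow> t \<in> T \<Longrightarrow> s \<le> t \<Longrightarrow>
      AE \<omega> in M. real_cond_exp M (F s) (X t) \<omega> \<le> X s \<omega>"

definition exp_bm :: "(real \<Rightarrow> 'a \<Rightarrow> real) \<Rightarrow> real \<Rightarrow> 'a \<Rightarrow> real" where
  "exp_bm B t \<omega> = exp (B t \<omega> - t / 2)"

definition int_exp_bm :: "(real \<Rightarrow> 'a \<Rightarrow> real) \<Rightarrow> real \<Rightarrow> 'a \<Rightarrow> real" where
  "int_exp_bm B t \<omega> = (LINT s:{0..t}|lborel. exp_bm B s \<omega>)"

text \<open>With \<open>X = exp_bm B / int_exp_bm B\<close>, Ito's formula gives \<open>exp (\<theta> * X)\<close> the drift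
  \<open>\<theta> * (\<theta> - 2) / 2 * X^2 * exp (\<theta> * X)\<close>, which is negative for \<open>0 < \<theta> < 2\<close>, zero for \<open>\<theta> = 0\<close>
  (constant process) and positive for \<open>\<theta> < 0\<close>. Hence the sign conditions on \<open>\<theta>\<close> in claims about
  the supermartingale property and strict decrease.\<close>

definition exp_ratio :: "(real \<Rightarrow> 'a \<Rightarrow> real) \<Rightarrow> real \<Rightarrow> real \<Rightarrow> 'a \<Rightarrow> real" where
  "exp_ratio B \<theta> t \<omega> = exp (\<theta> * exp_bm B t \<omega> / int_exp_bm B t \<omega>)"

end

theory Submission
  imports Defs
begin

text \<open>Put \<open>X = exp_bm B / int_exp_bm B\<close> and \<open>\<kappa> = 1 - \<theta> / 2\<close>. Formally \<open>dX = X dB - X\<^sup>2 dt\<close>, and for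
  \<open>0 \<le> \<theta> < 2\<close> the function \<open>u(t, x) = exp (\<theta> x / (1 + \<kappa> t x))\<close> satisfies
  \<open>\<partial>\<^sub>t u \<ge> x\<^sup>2 / 2 \<partial>\<^sub>x\<^sup>2 u - x\<^sup>2 \<partial>\<^sub>x u\<close> and \<open>u(0, x) = exp (\<theta> x)\<close>. Hence
  \<open>E[exp (\<theta> X\<^sub>t) | F\<^sub>s] \<le> exp (\<theta> X\<^sub>s / (1 + \<kappa> (t - s) X\<^sub>s))\<close> for \<open>0 < s < t\<close>. The right-hand side is at most
  \<open>exp (\<theta> X\<^sub>s)\<close>, and smaller if \<open>\<theta> > 0\<close>, which gives the supermartingale property and strict decrease, and it is bounded by
  \<open>exp (\<theta> / (\<kappa> (t - s)))\<close>, which gives integrability.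

  Stochastic calculus is avoided by replacing the integral over \<open>{s..t}\<close> by right Riemann sums with step \<open>\<delta>\<close>. Then
  \<open>X\<close> evolves by \<open>x \<mapsto> x G / (1 + \<delta> x G)\<close> with \<open>G\<close> log-normal, and since
  \<open>1 / (x G / (1 + \<delta> x G)) + c = 1 / (x G) + (c + \<delta>)\<close>, one step turns \<open>exp (\<theta> x / (1 + c x))\<close> into the
  expectation of the same function at \<open>x G\<close> with parameter \<open>c + \<delta>\<close>. A Taylor expansion in \<open>ln x\<close> bounds it
  by \<open>exp (\<theta> x / (1 + (c + \<kappa> \<delta>) x))\<close> up to \<open>O(\<delta>\<^bsup>3/2\<^esup>)\<close>, uniformly as long as \<open>c \<ge> c\<^sub>0 > 0\<close>. Finally \<open>\<delta> \<rightarrow> 0\<close>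
  and then \<open>c\<^sub>0 \<rightarrow> 0\<close>.\<close>

subsection \<open>Taylor expansion of the supersolution\<close>

text \<open>Taylor's theorem with Lagrange remainder \<open>f3 t / 6 * g ^ 3\<close>. It needs two
  distinct points, whence the separate trivial case \<open>g = 0\<close>.\<close>

lemma taylor_cubic_remainder:
  fixes f f1 f2 f3 :: "real \<Rightarrow> real"
  assumes f1: "\<And>y. (f has_real_derivative f1 y) (at y)"
    and f2: "\<And>y. (f1 has_real_derivative f2 y) (at y)"
    and f3: "\<And>y. (f2 has_real_derivative f3 y) (at y)"
    and K: "\<And>y. \<bar>f3 y\<bar> \<le> K"
  shows "\<bar>f (y + g) - (f y + f1 y * g + f2 y * g\<^sup>2 / 2)\<bar> \<le> K / 6 * \<bar>g\<bar> ^ 3"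
proof (cases "g = 0")
  case False
  define d where "d = (\<lambda>m::nat. if m = 0 then f else if m = 1 then f1 else if m = 2 then f2 else f3)"
  have "\<forall>m t. m < 3 \<and> min y (y + g) \<le> t \<and> t \<le> max y (y + g) \<longrightarrow> DERIV (d m) t :> d (Suc m) t"
    using f1 f2 f3 by (auto simp: d_def less_Suc_eq numeral_3_eq_3)
  from Taylor[OF _ _ this, of f y "y + g"] False obtain t
    where "f (y + g) = (\<Sum>m<3. (d m y / fact m) * (y + g - y)^m) + (d 3 t / fact 3) * (y + g - y)^3"
    by (auto simp: d_def split: if_splits)
  then have "f (y + g) - (f y + f1 y * g + f2 y * g\<^sup>2 / 2) = f3 t / 6 * g ^ 3"
    by (simp add: d_def eval_nat_numeral)
  moreover have "\<bar>f3 t / 6 * g ^ 3\<bar> \<le> K / 6 * \<bar>g\<bar> ^ 3"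
    using K[of t] by (auto simp: abs_mult power_abs intro!: mult_right_mono)
  ultimately show ?thesis by (simp only:)
qed simp

text \<open>For \<open>x > 0\<close> one has \<open>x / (1 + c * x) = 1 / (1 / x + c)\<close>, so
  the parameter shifts the reciprocal of \<open>x\<close>. At \<open>c = 0\<close> this is the
  exponential under study; for \<open>c > 0\<close> it is bounded on
  \<open>x \<ge> 0\<close>.\<close>

definition damped :: "real \<Rightarrow> real \<Rightarrow> real \<Rightarrow> real" where
  "damped \<theta> c x = exp (\<theta> * x / (1 + c * x))"

lemma damped_antimono:
  assumes "0 \<le> c" "c \<le> c'" "0 \<le> \<theta>" "0 \<le> x"
  shows "damped \<theta> c' x \<le> damped \<theta> c x"
  unfolding damped_def using assms
  by (auto intro!: divide_left_mono mult_right_mono mult_pos_pos add_pos_nonneg)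

lemma damped_less:
  assumes "0 < c" "0 < \<theta>" "0 < x"
  shows "damped \<theta> c x < damped \<theta> 0 x"
proof -
  have "1 < 1 + c * x" using assms by simp
  from divide_strict_left_mono[OF this, of "\<theta> * x"] show ?thesis
    unfolding damped_def using assms by (simp add: add_pos_pos)
qed

text \<open>For \<open>c > 0\<close> this is the logistic function at \<open>y + ln c\<close>. It
  satisfies \<open>p' = p * (1 - p)\<close>, so all derivatives of
  \<open>damped \<theta> c (exp y)\<close> in \<open>y\<close> are polynomials in \<open>p\<close>
  times an exponential.\<close>

definition logit_p :: "real \<Rightarrow> real \<Rightarrow> real" where
  "logit_p c y = c * exp y / (1 + c * exp y)"

lemma logit_p_bounds: "c > 0 \<Longrightarrow> 0 \<le> logit_p c y \<and> logit_p c y \<le> 1"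
  unfolding logit_p_def by (auto simp: add_pos_pos divide_le_eq_1 intro!: divide_nonneg_pos)

lemma DERIV_logit_p:
  assumes "c > 0"
  shows "(logit_p c has_real_derivative logit_p c y * (1 - logit_p c y)) (at y)"
proof -
  have "1 + c * exp y > 0" using assms by (simp add: add_pos_pos)
  then show ?thesis
    unfolding logit_p_def[abs_def]
    by (auto intro!: derivative_eq_intros simp: field_simps power2_eq_square)
qed

lemma damped_exp: "c > 0 \<Longrightarrow> damped \<theta> c (exp y) = exp (\<theta> / c * logit_p c y)"
  by (simp add: damped_def logit_p_def)

text \<open>The derivatives of \<open>y \<mapsto> damped \<theta> c (exp y)\<close>, which is \<open>exp (\<theta> / c * p)\<close> for the
  logistic function \<open>p = logit_p c\<close>.\<close>

definition damped1 :: "real \<Rightarrow> real \<Rightarrow> real \<Rightarrow> real" where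
  "damped1 \<theta> c y = (let a = \<theta> / c; p = logit_p c y in
     a * (p * (1 - p)) * exp (a * p))"

definition damped2 :: "real \<Rightarrow> real \<Rightarrow> real \<Rightarrow> real" where
  "damped2 \<theta> c y = (let a = \<theta> / c; p = logit_p c y in
     (a * (p * (1 - p)) * (1 - 2 * p) + (a * (p * (1 - p)))\<^sup>2) * exp (a * p))"

definition damped3 :: "real \<Rightarrow> real \<Rightarrow> real \<Rightarrow> real" where
  "damped3 \<theta> c y = (let a = \<theta> / c; p = logit_p c y; q = p * (1 - p) in
     (a * q * (1 - 2 * p)\<^sup>2 - 2 * a * q\<^sup>2 + 2 * a\<^sup>2 * q\<^sup>2 * (1 - 2 * p)
      + (a * q * (1 - 2 * p) + (a * q)\<^sup>2) * (a * q)) * exp (a * p))"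

lemma DERIV_damped:
  assumes "c > 0"
  shows "((\<lambda>y. damped \<theta> c (exp y)) has_real_derivative damped1 \<theta> c y) (at y)"
    and "(damped1 \<theta> c has_real_derivative damped2 \<theta> c y) (at y)"
    and "(damped2 \<theta> c has_real_derivative damped3 \<theta> c y) (at y)"
proof -
  define a where "a = \<theta> / c"
  define p where "p = logit_p c"
  note D = DERIV_logit_p[OF assms, folded p_def]
  have E: "((\<lambda>y. exp (a * p y)) has_real_derivative a * (p y * (1 - p y)) * exp (a * p y)) (at y)" for y
    by (rule derivative_eq_intros D refl | simp)+
  note defs = damped_exp[OF assms] damped1_def[abs_def] damped2_def[abs_def] damped3_def[abs_def] Let_def
    a_def[symmetric] p_def[symmetric]
  show "((\<lambda>y. damped \<theta> c (exp y)) has_real_derivative damped1 \<theta> c y) (at y)"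
    unfolding defs by (rule E)
  show "(damped1 \<theta> c has_real_derivative damped2 \<theta> c y) (at y)"
    unfolding defs
    by (rule derivative_eq_intros E D refl)+ (simp add: algebra_simps power2_eq_square)
  show "(damped2 \<theta> c has_real_derivative damped3 \<theta> c y) (at y)"
    unfolding defs
    by (rule derivative_eq_intros E D refl)+ (simp add: algebra_simps power2_eq_square)
qed

text \<open>Termwise bound of the polynomial factor of \<open>damped3\<close>, with each factor
  built from \<open>p\<close> alone replaced by 1. It also dominates the shorter factors of
  \<open>damped1\<close> and \<open>damped2\<close>.\<close>

definition damped_bound :: "real \<Rightarrow> real" where
  "damped_bound a = (a + 2 * a + 2 * a\<^sup>2 + (a + a\<^sup>2) * a) * exp a"

text \<open>The logistic value lies between 0 and 1 and
  \<open>\<theta> / c \<le> \<theta> / c0\<close>, so one constant serves all \<open>y\<close> and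
  all \<open>c \<ge> c0\<close>. This uniformity allows the errors of all time steps to be added
  although the parameter changes from step to step.\<close>

lemma damped_bounds:
  assumes "c0 > 0" "c \<ge> c0" "\<theta> \<ge> 0"
  shows "\<bar>damped1 \<theta> c y\<bar> \<le> damped_bound (\<theta> / c0)"
    and "\<bar>damped2 \<theta> c y\<bar> \<le> damped_bound (\<theta> / c0)"
    and "\<bar>damped3 \<theta> c y\<bar> \<le> damped_bound (\<theta> / c0)"
proof -
  define a where "a = \<theta> / c"
  define b where "b = \<theta> / c0"
  define p where "p = logit_p c y"
  define q where "q = p * (1 - p)"
  have a: "0 \<le> a" "a \<le> b" using assms by (auto simp: a_def b_def intro!: divide_left_mono)
  have p: "0 \<le> p" "p \<le> 1" using logit_p_bounds[of c y] assms by (auto simp: p_def)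
  have q: "0 \<le> q" "q \<le> 1" using p by (auto simp: q_def mult_le_one)
  have aq: "\<bar>a * q\<bar> \<le> b" using a q mult_mono[of a b q 1] by (simp)
  have p2: "\<bar>1 - 2 * p\<bar> \<le> 1" using p by auto
  have e: "exp (a * p) \<le> exp b" using a p mult_mono[of a b p 1] by simp
  have aqp: "\<bar>a * q * (1 - 2 * p)\<bar> \<le> b"
    using mult_mono[OF aq p2] a by (simp add: abs_mult)
  have aq2: "\<bar>(a * q)\<^sup>2\<bar> \<le> b\<^sup>2"
    using power_mono[OF aq, of 2] by simp
  have mult_exp: "\<bar>u * exp (a * p)\<bar> \<le> damped_bound b" if "\<bar>u\<bar> \<le> b + 2 * b + 2 * b\<^sup>2 + (b + b\<^sup>2) * b" for u
    unfolding damped_bound_def abs_mult using that e a by (intro mult_mono) auto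
  have b: "0 \<le> b" "0 \<le> (b + b\<^sup>2) * b" "0 \<le> b\<^sup>2" using a by auto
  show "\<bar>damped1 \<theta> c y\<bar> \<le> damped_bound (\<theta> / c0)"
    unfolding damped1_def Let_def a_def[symmetric] b_def[symmetric] p_def[symmetric] q_def[symmetric]
    using aq b by (intro mult_exp) linarith
  show "\<bar>damped2 \<theta> c y\<bar> \<le> damped_bound (\<theta> / c0)"
    unfolding damped2_def Let_def a_def[symmetric] b_def[symmetric] p_def[symmetric] q_def[symmetric]
    using aqp aq2 b by (intro mult_exp) linarith
  have 1: "\<bar>a * q * (1 - 2 * p)\<^sup>2\<bar> \<le> b"
    using mult_mono[OF aqp p2] a by (simp add: abs_mult power2_eq_square)
  have 2: "\<bar>2 * a * q\<^sup>2\<bar> \<le> 2 * b"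
    using mult_mono[OF aq, of "\<bar>q\<bar>" 1] a q by (simp add: abs_mult power2_eq_square)
  have 3: "\<bar>2 * a\<^sup>2 * q\<^sup>2 * (1 - 2 * p)\<bar> \<le> 2 * b\<^sup>2"
    using mult_mono[OF aq2 p2] by (simp add: abs_mult power_mult_distrib)
  have 4: "\<bar>(a * q * (1 - 2 * p) + (a * q)\<^sup>2) * (a * q)\<bar> \<le> (b + b\<^sup>2) * b"
    unfolding abs_mult[of "a * q * (1 - 2 * p) + (a * q)\<^sup>2"]
    using aqp aq2 aq b by (intro mult_mono) linarith+
  show "\<bar>damped3 \<theta> c y\<bar> \<le> damped_bound (\<theta> / c0)"
    unfolding damped3_def Let_def a_def[symmetric] b_def[symmetric] p_def[symmetric] q_def[symmetric]
    using 1 2 3 4 by (intro mult_exp) linarith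
qed

text \<open>The infinitesimal form of the supersolution property: in the variable \<open>y = ln x\<close>, the generator
  \<open>x\<^sup>2 \<partial>\<^sub>x\<^sup>2 / 2\<close> of geometric Brownian motion is half the difference of the second and first derivatives.\<close>

lemma damped_supersolution:
  assumes "c > 0" "\<theta> \<ge> 0" "\<delta> \<ge> 0" "c - \<theta> * \<delta> / 2 \<ge> 0"
  shows "damped \<theta> c (exp y) + \<delta> / 2 * (damped2 \<theta> c y - damped1 \<theta> c y)
    \<le> damped \<theta> (c - \<theta> * \<delta> / 2) (exp y)"
proof -
  define x where "x = exp y"
  have x: "x > 0" by (simp add: x_def)
  define v where "v = 1 + c * x"
  define w where "w = 1 + (c - \<theta> * \<delta> / 2) * x"
  define r where "r = x / v"
  define \<eta> where "\<eta> = \<theta> * \<delta> / 2"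
  have v: "v > 0" using assms x by (simp add: v_def add_pos_pos)
  have w: "w \<ge> 1" "w \<le> v" using assms x
    by (auto simp: w_def v_def algebra_simps)
  define a where "a = \<theta> / c"
  define p where "p = logit_p c y"
  have ap: "a * p = \<theta> * r"
    using assms by (simp add: a_def p_def logit_p_def r_def v_def x_def)
  have p: "0 \<le> p" "p \<le> 1" using logit_p_bounds[of c y] assms by (auto simp: p_def)
  have a: "a \<ge> 0" using assms by (simp add: a_def)
  \<comment> \<open>The summand \<open>a * (p * (1 - p))\<close> of \<open>damped2\<close> cancels
    against \<open>damped1\<close>. There remain a nonpositive term, dropped next, and a square
    bounded by \<open>(a * p)\<^sup>2\<close>.\<close>
  have "damped2 \<theta> c y - damped1 \<theta> c y = (a * (p * (1 - p)) * (- 2 * p) + (a * p)\<^sup>2 * (1 - p)\<^sup>2) * exp (a * p)"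
    by (simp add: damped2_def damped1_def Let_def a_def[symmetric] p_def[symmetric] power2_eq_square algebra_simps)
  also have "\<dots> \<le> (a * p)\<^sup>2 * exp (a * p)"
  proof (intro mult_right_mono)
    have "a * (p * (1 - p)) * (- 2 * p) \<le> 0"
      using a p by (simp add: mult_nonneg_nonneg)
    moreover have "(a * p)\<^sup>2 * (1 - p)\<^sup>2 \<le> (a * p)\<^sup>2 * 1"
      using p by (intro mult_left_mono) (auto simp: power_le_one)
    ultimately show "a * (p * (1 - p)) * (- 2 * p) + (a * p)\<^sup>2 * (1 - p)\<^sup>2 \<le> (a * p)\<^sup>2" by linarith
  qed simp
  finally have "damped \<theta> c (exp y) + \<delta> / 2 * (damped2 \<theta> c y - damped1 \<theta> c y)
      \<le> exp (\<theta> * r) + \<delta> / 2 * ((\<theta> * r)\<^sup>2 * exp (\<theta> * r))"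
    using assms by (simp add: mult_left_mono ap damped_def r_def x_def v_def)
  also have "\<dots> = (1 + \<theta> * (\<eta> * r\<^sup>2)) * exp (\<theta> * r)"
    by (simp add: \<eta>_def power2_eq_square algebra_simps)
  \<comment> \<open>\<open>1 + z \<le> exp z\<close> moves the second-order term into the
    exponent.\<close>
  also have "\<dots> \<le> exp (\<theta> * (\<eta> * r\<^sup>2)) * exp (\<theta> * r)"
    by (intro mult_right_mono) auto
  also have "\<dots> = exp (\<theta> * (r + \<eta> * r\<^sup>2))"
    by (simp add: exp_add[symmetric] algebra_simps)
  \<comment> \<open>Since \<open>w = v - \<eta> * x\<close>, \<open>x / w\<close> equals
    \<open>r / (1 - \<eta> * r)\<close>, and \<open>r + \<eta> * r\<^sup>2\<close> is the start of
    its geometric series; the difference computed below is the nonnegative rest.\<close>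
  also have "\<dots> \<le> exp (\<theta> * (x / w))"
  proof -
    have \<eta>: "\<eta> = (v - w) / x"
      using x by (simp add: v_def w_def \<eta>_def field_simps)
    have "x / w - (r + \<eta> * r\<^sup>2) = x * (v - w)\<^sup>2 / (w * v\<^sup>2)"
      using v w x unfolding r_def \<eta> by (simp add: divide_simps power2_eq_square) (simp add: algebra_simps)
    moreover have "x * (v - w)\<^sup>2 / (w * v\<^sup>2) \<ge> 0"
      using v w x by simp
    ultimately have "r + \<eta> * r\<^sup>2 \<le> x / w" by linarith
    from mult_left_mono[OF this, of \<theta>] show ?thesis using assms by simp
  qed
  also have "\<dots> = damped \<theta> (c - \<theta> * \<delta> / 2) (exp y)"
    by (simp add: damped_def w_def x_def)
  finally show ?thesis .
qed

section \<open>Boundedness and measurability of the damped functions; the accumulated error\<close>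

lemma damped_nonneg [simp]: "0 \<le> damped \<theta> c x"
  by (simp add: damped_def)

text \<open>Positive damping caps the exponent at \<open>\<theta> / c0\<close> however large
  \<open>x\<close> is. This is the source of integrability and of dominating constants as long as
  the damping is positive.\<close>

lemma damped_le:
  assumes "c0 > 0" "c \<ge> c0" "\<theta> \<ge> 0" "x \<ge> 0"
  shows "damped \<theta> c x \<le> exp (\<theta> / c0)"
proof -
  have "x / (1 + c * x) \<le> 1 / c0"
    using assms mult_right_mono[of c0 c x] by (auto simp: field_simps add_pos_nonneg)
  from mult_left_mono[OF this assms(3)] show ?thesis by (simp add: damped_def)
qed

lemma borel_measurable_damped [measurable]: "damped \<theta> c \<in> borel_measurable borel"
  unfolding damped_def[abs_def] by measurable

lemma borel_measurable_logit_p [measurable]: "logit_p c \<in> borel_measurable borel"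
  unfolding logit_p_def[abs_def] by measurable

lemma borel_measurable_damped1 [measurable]: "damped1 \<theta> c \<in> borel_measurable borel"
  unfolding damped1_def[abs_def] Let_def by measurable

lemma borel_measurable_damped2 [measurable]: "damped2 \<theta> c \<in> borel_measurable borel"
  unfolding damped2_def[abs_def] Let_def by measurable

text \<open>\<open>\<delta>\<^sup>2\<close> pays for the excess of the second moment of the
  log-increment over \<open>\<delta>\<close>, the other summands for its third absolute moment; the
  coefficients are rounded up.\<close>

definition step_error :: "real \<Rightarrow> real \<Rightarrow> real" where
  "step_error K \<delta> = K * (\<delta>\<^sup>2 + sqrt \<delta> ^ 3 * 2 + \<delta> ^ 3)"

text \<open>The leading order in the step is the power 3/2, so \<open>n\<close> steps of length
  \<open>h / n\<close> contribute a total of order \<open>1 / sqrt n\<close>.\<close>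

lemma step_error_tendsto:
  assumes "h > 0"
  shows "(\<lambda>n. real n * step_error K (h / real n)) \<longlonglongrightarrow> 0"
proof -
  have "(\<lambda>n. K * (h\<^sup>2 * (1 / real n) + 2 * h * sqrt (h * (1 / real n)) + h ^ 3 * (1 / real n)\<^sup>2))
    \<longlonglongrightarrow> K * (h\<^sup>2 * 0 + 2 * h * sqrt (h * 0) + h ^ 3 * 0\<^sup>2)"
    by (intro tendsto_intros lim_1_over_n)
  then have "(\<lambda>n. K * (h\<^sup>2 * (1 / real n) + 2 * h * sqrt (h * (1 / real n)) + h ^ 3 * (1 / real n)\<^sup>2)) \<longlonglongrightarrow> 0"
    by simp
  then show ?thesis
  proof (rule Lim_transform_eventually)
    have eq: "K * (h\<^sup>2 * (1 / real n) + 2 * h * sqrt (h * (1 / real n)) + h ^ 3 * (1 / real n)\<^sup>2) = real n * step_error K (h / real n)"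
      if "n > 0" for n
    proof -
      have "sqrt (h / real n) ^ 3 = h / real n * sqrt (h / real n)"
        using assms by (simp add: power3_eq_cube)
      then show ?thesis using that assms
        by (simp add: step_error_def field_simps power2_eq_square power3_eq_cube)
    qed
    show "\<forall>\<^sub>F n in sequentially. K * (h\<^sup>2 * (1 / real n) + 2 * h * sqrt (h * (1 / real n)) + h ^ 3 * (1 / real n)\<^sup>2) = real n * step_error K (h / real n)"
      by (rule eventually_mono[OF eventually_gt_at_top[of 0] eq])
  qed
qed

subsection \<open>Right Riemann sums\<close>

lemma right_rectangle_error:
  fixes f :: "real \<Rightarrow> real"
  assumes "a \<le> b" "continuous_on {a..b} f" "\<And>x. x \<in> {a..b} \<Longrightarrow> \<bar>f x - f b\<bar> \<le> e"
  shows "\<bar>integral {a..b} f - (b - a) * f b\<bar> \<le> e * (b - a)"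
proof -
  have "integral {a..b} (\<lambda>x. f x - f b) = integral {a..b} f - (b - a) * f b"
    using assms by (subst integral_diff) (auto intro!: integrable_continuous_interval)
  moreover have "norm (integral {a..b} (\<lambda>x. f x - f b)) \<le> e * (b - a)"
    using assms by (intro integral_bound continuous_intros) auto
  ultimately show ?thesis by simp
qed

text \<open>By uniform continuity each cell shorter than \<open>d\<close> has error at most
  \<open>e\<close> times its length, and these errors add up. Used both for adaptedness of the
  integral and for the limit of the discretization.\<close>

lemma right_riemann_sum_tendsto:
  fixes f :: "real \<Rightarrow> real"
  assumes ab: "a < b" and f: "continuous_on {a..b} f"
  shows "(\<lambda>n. \<Sum>i<n. (b - a) / real n * f (a + real (Suc i) * ((b - a) / real n)))
    \<longlonglongrightarrow> integral {a..b} f"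
proof (rule LIMSEQ_I)
  fix r :: real assume r: "r > 0"
  \<comment> \<open>Chosen so that the total error \<open>e * (b - a)\<close> is
    \<open>r / 2\<close>.\<close>
  define e where "e = r / (2 * (b - a))"
  have e: "e > 0" "e * (b - a) < r" using r ab by (auto simp: e_def field_simps)
  have "uniformly_continuous_on {a..b} f"
    using f by (intro compact_uniformly_continuous) auto
  then obtain d where d: "d > 0" "\<And>x x'. x \<in> {a..b} \<Longrightarrow> x' \<in> {a..b} \<Longrightarrow> dist x' x < d \<Longrightarrow> dist (f x') (f x) < e"
    using e(1) unfolding uniformly_continuous_on_def by metis
  obtain N where N: "real N > (b - a) / d" using reals_Archimedean2 by blast
  have "norm ((\<Sum>i<n. (b - a) / real n * f (a + real (Suc i) * ((b - a) / real n))) - integral {a..b} f) < r"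
    if "n \<ge> Suc N" for n
  proof -
    define h where "h = (b - a) / real n"
    have n: "real n > 0" "real n > (b - a) / d" using that N by auto
    have h: "h > 0" "h < d" "real n * h = b - a"
      using n ab d(1) by (auto simp: h_def field_simps)
    have "\<bar>integral {a..a + real k * h} f - (\<Sum>i<k. h * f (a + real (Suc i) * h))\<bar> \<le> e * (real k * h)" if "k \<le> n" for k
      using that
    proof (induction k)
      case (Suc k)
      define u v where "u = a + real k * h" and "v = a + real (Suc k) * h"
      have "real (Suc k) * h \<le> real n * h" using Suc.prems h by (intro mult_right_mono) auto
      then have v: "v \<le> b" using h by (simp add: v_def)
      have u: "a \<le> u" "u \<le> v" "v - u = h" using h by (auto simp: u_def v_def algebra_simps)
      have fuv: "continuous_on {u..v} f" by (rule continuous_on_subset[OF f]) (use u v in auto)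
      have "\<bar>integral {u..v} f - (v - u) * f v\<bar> \<le> e * (v - u)"
      proof (rule right_rectangle_error[OF u(2) fuv])
        fix x assume "x \<in> {u..v}"
        then have "dist x v < d" "x \<in> {a..b}" "v \<in> {a..b}"
          using u v h by (auto simp: dist_real_def)
        from d(2)[OF this(3,2,1)] show "\<bar>f x - f v\<bar> \<le> e" by (simp add: dist_real_def)
      qed
      moreover have "integral {a..u} f + integral {u..v} f = integral {a..v} f"
        using u v by (intro Henstock_Kurzweil_Integration.integral_combine integrable_continuous_interval
            continuous_on_subset[OF f]) auto
      moreover have "\<bar>integral {a..u} f - (\<Sum>i<k. h * f (a + real (Suc i) * h))\<bar> \<le> e * (real k * h)"
        using Suc by (simp add: u_def)
      moreover have "e * (real k * h) + e * h = e * (real (Suc k) * h)" by (simp add: algebra_simps)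
      ultimately show ?case
        unfolding u(3) v_def[symmetric] by (simp only: sum.lessThan_Suc v_def[symmetric])
    qed simp
    from this[of n] h have "\<bar>integral {a..b} f - (\<Sum>i<n. h * f (a + real (Suc i) * h))\<bar> \<le> e * (b - a)" by simp
    with e(2) show ?thesis unfolding h_def[symmetric] by (simp add: abs_minus_commute)
  qed
  then show "\<exists>no. \<forall>n\<ge>no. norm ((\<Sum>i<n. (b - a) / real n * f (a + real (Suc i) * ((b - a) / real n))) - integral {a..b} f) < r"
    by blast
qed

subsection \<open>Independence of the increments from the natural filtration\<close>

lemma space_natural_filtration [simp]: "space (natural_filtration M B t) = space M"
  unfolding natural_filtration_def by (rule space_measure_of) auto

lemma sets_natural_filtration:
  "sets (natural_filtration M B t) =
     sigma_sets (space M) {B s -` U \<inter> space M | s U. 0 \<le> s \<and> s \<le> t \<and> U \<in> sets borel}"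
  unfolding natural_filtration_def by (rule sets_measure_of) auto

lemma filtration_natural_filtration: "filtration (space M) (natural_filtration M B)"
  by standard (auto simp: sets_natural_filtration intro!: sigma_sets_mono', fastforce)

lemma natural_filtration_mono: "s \<le> t \<Longrightarrow> sets (natural_filtration M B s) \<subseteq> sets (natural_filtration M B t)"
  using filtration.sets_F_mono[OF filtration_natural_filtration] by blast

context brownian_motion
begin

lemma subalgebra_natural_filtration: "subalgebra M (natural_filtration M B t)"
  unfolding subalgebra_def sets_natural_filtration
  using random_variable_B by (auto intro!: sets.sigma_sets_subset measurable_sets)

lemma B_adapted: "0 \<le> s \<Longrightarrow> s \<le> t \<Longrightarrow> B s \<in> borel_measurable (natural_filtration M B t)"
  by (rule measurableI) (auto simp: sets_natural_filtration)

text \<open>The values of \<open>B\<close> on \<open>J\<close> are, up to the null set where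
  \<open>B 0\<close> is not 0, partial sums of increments over a grid in \<open>{0..s}\<close>, and
  these are independent of the increment after \<open>s\<close>.\<close>

lemma indep_increment_cylinder:
  assumes st: "0 \<le> s" "s < t" and J: "finite J" "J \<subseteq> {0..s}"
    and U: "\<And>u. u \<in> J \<Longrightarrow> U u \<in> sets borel" and V: "V \<in> sets borel"
  shows "prob ({\<omega> \<in> space M. \<forall>u\<in>J. B u \<omega> \<in> U u} \<inter> ((\<lambda>\<omega>. B t \<omega> - B s \<omega>) -` V \<inter> space M)) =
    prob {\<omega> \<in> space M. \<forall>u\<in>J. B u \<omega> \<in> U u} * prob ((\<lambda>\<omega>. B t \<omega> - B s \<omega>) -` V \<inter> space M)"
proof -
  \<comment> \<open>Adding 0 and \<open>s\<close> makes the grid start where \<open>B\<close>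
    vanishes and end where the future increment begins.\<close>
  define xs where "xs = sorted_list_of_set (J \<union> {0, s})"
  define m where "m = length xs - 1"
  have set_xs: "set xs = J \<union> {0, s}"
    unfolding xs_def using J by (intro set_sorted_list_of_set) auto
  have sorted: "sorted_wrt (<) xs"
    unfolding xs_def by (rule strict_sorted_list_of_set)
  have "xs \<noteq> []" using set_xs by auto
  then have len: "length xs = Suc m" by (simp add: m_def)
  have less: "xs ! i < xs ! j" if "i < j" "j \<le> m" for i j
    using sorted_wrt_nth_less[OF sorted, of i j] that len by auto
  have le: "xs ! i \<le> xs ! j" if "i \<le> j" "j \<le> m" for i j
    using less[of i j] that by (cases "i = j") auto
  have idx: "\<exists>k\<le>m. u = xs ! k" if "u \<in> J \<union> {0, s}" for u
    using that len unfolding set_xs[symmetric] in_set_conv_nth by (auto simp: less_Suc_eq_le)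
  have mem: "xs ! k \<in> {0..s}" if "k \<le> m" for k
  proof -
    have "xs ! k \<in> set xs" using that len by (intro nth_mem) auto
    then show ?thesis unfolding set_xs using st J by auto
  qed
  have x0: "xs ! 0 = 0"
  proof -
    obtain k where "k \<le> m" "0 = xs ! k" using idx[of 0] by auto
    then show ?thesis using le[of 0 k] mem[of 0] by auto
  qed
  have xm: "xs ! m = s"
  proof -
    obtain k where "k \<le> m" "s = xs ! k" using idx[of s] by auto
    then show ?thesis using le[of k m] mem[of m] by auto
  qed
  \<comment> \<open>The grid followed by \<open>t\<close>, so increment number \<open>m\<close> is
    the one from \<open>s\<close> to \<open>t\<close>.\<close>
  define \<tau> where "\<tau> i = (if i \<le> m then xs ! i else t)" for i
  define X where "X i \<omega> = B (\<tau> (Suc i)) \<omega> - B (\<tau> i) \<omega>" for i \<omega>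
  have "indep_vars (\<lambda>_. borel) X {..<Suc m}"
    unfolding X_def[abs_def]
  proof (rule independent_increments)
    show "0 \<le> \<tau> 0" by (simp add: \<tau>_def x0)
    show "\<tau> i < \<tau> (Suc i)" if "i < Suc m" for i
      using that less[of i "Suc i"] xm st
      by (cases "i = m") (auto simp: \<tau>_def)
  qed
  \<comment> \<open>The past increments have indices below \<open>m\<close>, the future one has
    index \<open>m\<close>. If \<open>s = 0\<close>, then \<open>m = 0\<close> and the first block
    is empty.\<close>
  from indep_var_restrict[OF this, of "{..<m}" "{m}"]
  have ind: "indep_var (Pi\<^sub>M {..<m} (\<lambda>_. borel)) (\<lambda>\<omega>. \<lambda>i\<in>{..<m}. X i \<omega>)
      (Pi\<^sub>M {m} (\<lambda>_. borel)) (\<lambda>\<omega>. \<lambda>i\<in>{m}. X i \<omega>)" by auto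
  define K where "K = {k. k \<le> m \<and> xs ! k \<in> J}"
  have "finite K" by (simp add: K_def)
  define Ea where "Ea = {f \<in> space (Pi\<^sub>M {..<m} (\<lambda>_. borel :: real measure)). \<forall>k\<in>K. (\<Sum>i<k. f i) \<in> U (xs ! k)}"
  define Eb where "Eb = {f \<in> space (Pi\<^sub>M {m} (\<lambda>_. borel :: real measure)). f m \<in> V}"
  have Ea: "Ea \<in> sets (Pi\<^sub>M {..<m} (\<lambda>_. borel))"
    unfolding Ea_def
  proof (rule sets.sets_Collect_finite_All[OF _ \<open>finite K\<close>])
    fix k assume k: "k \<in> K"
    have [measurable]: "U (xs ! k) \<in> sets borel" using k U by (auto simp: K_def)
    have [measurable]: "(\<lambda>f. f i) \<in> borel_measurable (Pi\<^sub>M {..<m} (\<lambda>_. borel))" if "i \<in> {..<k}" for i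
      using k that by (intro measurable_component_singleton) (auto simp: K_def)
    have "(\<lambda>f. \<Sum>i<k. f i) \<in> borel_measurable (Pi\<^sub>M {..<m} (\<lambda>_. borel :: real measure))"
      by (intro borel_measurable_sum) auto
    then show "{f \<in> space (Pi\<^sub>M {..<m} (\<lambda>_. borel)). (\<Sum>i<k. f i) \<in> U (xs ! k)} \<in> sets (Pi\<^sub>M {..<m} (\<lambda>_. borel))"
      by measurable
  qed
  have Eb: "Eb \<in> sets (Pi\<^sub>M {m} (\<lambda>_. borel))"
    using V unfolding Eb_def by measurable
  have sum_X: "B (xs ! k) \<omega> - B 0 \<omega> = (\<Sum>i<k. X i \<omega>)" if "k \<le> m" for k \<omega>
    using sum_lessThan_telescope[of "\<lambda>i. B (\<tau> i) \<omega>" k] that by (simp add: X_def \<tau>_def x0)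
  have restr: "(\<Sum>i<k. (\<lambda>i\<in>{..<m}. X i \<omega>) i) = (\<Sum>i<k. X i \<omega>)" if "k \<le> m" for k \<omega>
    using that by (intro sum.cong) auto
  have Xm: "X m \<omega> = B t \<omega> - B s \<omega>" for \<omega> by (simp add: X_def \<tau>_def xm)
  \<comment> \<open>Holds only where \<open>B 0 \<omega> = 0\<close>, so the cylinder and its
    increment version are later exchanged by \<open>measure_eq_AE\<close> rather than by equality of
    sets.\<close>
  have iff: "(\<lambda>i\<in>{..<m}. X i \<omega>) \<in> Ea \<longleftrightarrow> (\<forall>u\<in>J. B u \<omega> \<in> U u)" if "B 0 \<omega> = 0" for \<omega>
  proof -
    have "(\<lambda>i\<in>{..<m}. X i \<omega>) \<in> Ea \<longleftrightarrow> (\<forall>k\<in>K. B (xs ! k) \<omega> \<in> U (xs ! k))"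
      using that sum_X[of _ \<omega>] by (auto simp: Ea_def space_PiM K_def restr)
    also have "\<dots> \<longleftrightarrow> (\<forall>u\<in>J. B u \<omega> \<in> U u)"
      using idx by (auto simp: K_def)
    finally show ?thesis .
  qed
  have iffb: "(\<lambda>i\<in>{m}. X i \<omega>) \<in> Eb \<longleftrightarrow> B t \<omega> - B s \<omega> \<in> V" for \<omega>
    by (auto simp: Eb_def space_PiM Xm)
  have rvX: "random_variable (Pi\<^sub>M {..<m} (\<lambda>_. borel)) (\<lambda>\<omega>. \<lambda>i\<in>{..<m}. X i \<omega>)"
    using ind by (auto simp: indep_var_eq)
  have rv: "random_variable borel (B u)" if "u \<ge> 0" for u using random_variable_B that .
  have [measurable]: "{\<omega> \<in> space M. \<forall>u\<in>J. B u \<omega> \<in> U u} \<in> sets M"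
    using J U by (intro sets.sets_Collect_finite_All measurable_sets_Collect[OF rv]) (auto)
  have [measurable]: "((\<lambda>\<omega>. B t \<omega> - B s \<omega>) -` V \<inter> space M) \<in> sets M"
    using rv[of t] rv[of s] st V by (intro measurable_sets[of _ M borel]) auto
  have [measurable]: "(\<lambda>\<omega>. \<lambda>i\<in>{..<m}. X i \<omega>) -` Ea \<inter> space M \<in> sets M"
    using rvX Ea by (rule measurable_sets)
  have a: "prob {\<omega> \<in> space M. \<forall>u\<in>J. B u \<omega> \<in> U u} = prob ((\<lambda>\<omega>. \<lambda>i\<in>{..<m}. X i \<omega>) -` Ea \<inter> space M)"
    using start by (intro measure_eq_AE) (auto simp: iff)
  have b: "(\<lambda>\<omega>. B t \<omega> - B s \<omega>) -` V \<inter> space M = (\<lambda>\<omega>. \<lambda>i\<in>{m}. X i \<omega>) -` Eb \<inter> space M"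
    by (auto simp: iffb)
  have "prob ({\<omega> \<in> space M. \<forall>u\<in>J. B u \<omega> \<in> U u} \<inter> ((\<lambda>\<omega>. B t \<omega> - B s \<omega>) -` V \<inter> space M)) =
    prob (((\<lambda>\<omega>. \<lambda>i\<in>{..<m}. X i \<omega>) -` Ea \<inter> space M) \<inter> ((\<lambda>\<omega>. B t \<omega> - B s \<omega>) -` V \<inter> space M))"
    using start by (intro measure_eq_AE) (auto simp: iff)
  also have "\<dots> = prob ((\<lambda>\<omega>. (\<lambda>i\<in>{..<m}. X i \<omega>, \<lambda>i\<in>{m}. X i \<omega>)) -` (Ea \<times> Eb) \<inter> space M)"
    by (intro arg_cong[where f=prob]) (auto simp: iffb)
  also have "\<dots> = prob ((\<lambda>\<omega>. \<lambda>i\<in>{..<m}. X i \<omega>) -` Ea \<inter> space M) * prob ((\<lambda>\<omega>. \<lambda>i\<in>{m}. X i \<omega>) -` Eb \<inter> space M)"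
    by (rule indep_varD[OF ind Ea Eb])
  finally show ?thesis by (simp only: a b)
qed

text \<open>Finite-dimensional cylinders are stable under intersection and generate the filtration,
  so their independence extends to the generated sigma-algebras.\<close>

lemma indep_increment:
  assumes st: "0 \<le> s" "s < t"
  shows "indep_set (sets (natural_filtration M B s))
    (sigma_sets (space M) {(\<lambda>\<omega>. B t \<omega> - B s \<omega>) -` V \<inter> space M | V. V \<in> sets borel})"
proof -
  define C where "C = {{\<omega> \<in> space M. \<forall>u\<in>J. B u \<omega> \<in> U u} | J U.
    finite J \<and> J \<subseteq> {0..s} \<and> (\<forall>u\<in>J. U u \<in> sets borel)}"
  define D where "D = {(\<lambda>\<omega>. B t \<omega> - B s \<omega>) -` V \<inter> space M | V. V \<in> sets (borel :: real measure)}"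
  have rv: "random_variable borel (B u)" if "u \<ge> 0" for u using random_variable_B that .
  have C: "C \<subseteq> events"
    unfolding C_def by (auto intro!: sets.sets_Collect_finite_All measurable_sets_Collect[OF rv])
  have D: "D \<subseteq> events"
    using rv[of t] rv[of s] st unfolding D_def by (auto intro!: measurable_sets[of _ M borel])
  have "indep_set C D"
    unfolding indep_set_def
  proof (rule indep_setI[unfolded indep_set_def, OF C D])
    fix a b assume "a \<in> C" "b \<in> D"
    then show "prob (a \<inter> b) = prob a * prob b"
      unfolding C_def D_def using indep_increment_cylinder[OF st] by blast
  qed
  moreover have "Int_stable C"
  proof (rule Int_stableI)
    fix a b assume "a \<in> C" "b \<in> C"
    then obtain J U J' U' where a: "a = {\<omega> \<in> space M. \<forall>u\<in>J. B u \<omega> \<in> U u}" "finite J" "J \<subseteq> {0..s}" "\<forall>u\<in>J. U u \<in> sets borel"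
      and b: "b = {\<omega> \<in> space M. \<forall>u\<in>J'. B u \<omega> \<in> U' u}" "finite J'" "J' \<subseteq> {0..s}" "\<forall>u\<in>J'. U' u \<in> sets borel"
      unfolding C_def by blast
    \<comment> \<open>\<open>UNIV\<close> stands for the absent constraint at times belonging to
      only one of the two index sets.\<close>
    define W where "W u = (if u \<in> J then U u else UNIV) \<inter> (if u \<in> J' then U' u else UNIV)" for u
    have "a \<inter> b = {\<omega> \<in> space M. \<forall>u\<in>J \<union> J'. B u \<omega> \<in> W u}"
      unfolding a(1) b(1) W_def by auto
    moreover have "finite (J \<union> J')" "J \<union> J' \<subseteq> {0..s}" "\<forall>u\<in>J \<union> J'. W u \<in> sets borel"
      using a b by (auto simp: W_def)
    ultimately show "a \<inter> b \<in> C" unfolding C_def by blast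
  qed
  moreover have "Int_stable D"
  proof (rule Int_stableI)
    fix a b assume "a \<in> D" "b \<in> D"
    then obtain V W where "a = (\<lambda>\<omega>. B t \<omega> - B s \<omega>) -` V \<inter> space M" "b = (\<lambda>\<omega>. B t \<omega> - B s \<omega>) -` W \<inter> space M"
      "V \<in> sets borel" "W \<in> sets borel" unfolding D_def by blast
    then show "a \<inter> b \<in> D" unfolding D_def by (intro CollectI exI[of _ "V \<inter> W"]) auto
  qed
  ultimately have "indep_set (sigma_sets (space M) C) (sigma_sets (space M) D)"
    by (rule indep_set_sigma_sets)
  moreover have "sets (natural_filtration M B s) \<subseteq> sigma_sets (space M) C"
    unfolding sets_natural_filtration
  proof (rule sigma_sets_mono', safe)
    fix u and U :: "real set" assume u: "0 \<le> u" "u \<le> s" "U \<in> sets borel"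
    show "B u -` U \<inter> space M \<in> C"
      unfolding C_def using u
      by (intro CollectI exI[of _ "{u}"] exI[of _ "\<lambda>_. U"]) auto
  qed
  ultimately show ?thesis
    unfolding D_def indep_set_def
    by (rule_tac indep_sets_mono_sets) (auto split: bool.split)
qed

lemma indep_var_increment:
  assumes st: "0 \<le> s" "s < t" and Y: "Y \<in> borel_measurable (natural_filtration M B s)"
  shows "indep_var borel (Y :: 'a \<Rightarrow> real) borel (\<lambda>\<omega>. B t \<omega> - B s \<omega>)"
  unfolding indep_var_eq
proof (intro conjI)
  show "random_variable borel Y"
    using measurable_from_subalg[OF subalgebra_natural_filtration Y] .
  show "random_variable borel (\<lambda>\<omega>. B t \<omega> - B s \<omega>)"
    using random_variable_B[of s] random_variable_B[of t] st by auto
  have "sigma_sets (space M) {Y -` A \<inter> space M |A. A \<in> sets borel} \<subseteq> sets (natural_filtration M B s)"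
  proof -
    have "sigma_sets (space (natural_filtration M B s)) {Y -` A \<inter> space M |A. A \<in> sets borel} \<subseteq> sets (natural_filtration M B s)"
      using measurable_sets[OF Y] by (intro sets.sigma_sets_subset) auto
    then show ?thesis by simp
  qed
  with indep_increment[OF st] show "indep_set (sigma_sets (space M) {Y -` A \<inter> space M |A. A \<in> sets borel})
     (sigma_sets (space M) {(\<lambda>\<omega>. B t \<omega> - B s \<omega>) -` A \<inter> space M |A. A \<in> sets borel})"
    unfolding indep_set_def
    by (rule_tac indep_sets_mono_sets) (auto split: bool.split)
qed

subsection \<open>One step of the discretized process\<close>

lemma has_expectation_increment:
  assumes st: "0 \<le> s" "s < t" and g[measurable]: "g \<in> borel_measurable borel"
    and I: "has_bochner_integral lborel (\<lambda>x. normal_density 0 (sqrt (t - s)) x * g x) I"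
  shows "integrable M (\<lambda>\<omega>. g (B t \<omega> - B s \<omega>))" "expectation (\<lambda>\<omega>. g (B t \<omega> - B s \<omega>)) = I"
proof -
  note D = gaussian_increments[OF st]
  show "integrable M (\<lambda>\<omega>. g (B t \<omega> - B s \<omega>))"
    using distributed_integrable[OF D _ , of g] I by (auto simp: has_bochner_integral_iff)
  show "expectation (\<lambda>\<omega>. g (B t \<omega> - B s \<omega>)) = I"
    using distributed_integral[OF D _ , of g] I by (auto simp: has_bochner_integral_iff)
qed

lemma increment_moments:
  assumes st: "0 \<le> s" "s < t"
  defines "b \<equiv> \<lambda>\<omega>. B t \<omega> - B s \<omega>"
  shows "integrable M b" "expectation b = 0"
    "integrable M (\<lambda>\<omega>. (b \<omega>)\<^sup>2)" "expectation (\<lambda>\<omega>. (b \<omega>)\<^sup>2) = t - s"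
    "integrable M (\<lambda>\<omega>. \<bar>b \<omega>\<bar> ^ 3)" "expectation (\<lambda>\<omega>. \<bar>b \<omega>\<bar> ^ 3) \<le> 2 * sqrt (t - s) ^ 3"
proof -
  have p: "0 < sqrt (t - s)" using st by simp
  show "integrable M b" "expectation b = 0"
    using has_expectation_increment[OF st, of "\<lambda>x. x"] normal_moment_odd[OF p, of 0 0] by (auto simp: b_def)
  show "integrable M (\<lambda>\<omega>. (b \<omega>)\<^sup>2)" "expectation (\<lambda>\<omega>. (b \<omega>)\<^sup>2) = t - s"
    using has_expectation_increment[OF st, of "\<lambda>x. x\<^sup>2"] normal_moment_even[OF p, of 0 1] st by (auto simp: b_def)
  \<comment> \<open>The third absolute moment of the centred normal law carries the factor
    \<open>sqrt (2 / pi)\<close>, which is rounded up to 1.\<close>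
  have "sqrt (2 / pi) \<le> sqrt 1" using pi_gt3 by (intro real_sqrt_le_mono) simp
  then have "2 * sqrt (t - s) ^ 3 * sqrt (2 / pi) \<le> 2 * sqrt (t - s) ^ 3 * 1"
    using p by (intro mult_left_mono) auto
  then show "integrable M (\<lambda>\<omega>. \<bar>b \<omega>\<bar> ^ 3)" "expectation (\<lambda>\<omega>. \<bar>b \<omega>\<bar> ^ 3) \<le> 2 * sqrt (t - s) ^ 3"
    using has_expectation_increment[OF st, of "\<lambda>x. \<bar>x\<bar> ^ 3"] normal_moment_abs_odd[OF p, of 0 1]
    by (auto simp: b_def)
qed

text \<open>Second-order expansion in \<open>y = ln R\<close>, with the independent log-increment
  \<open>g\<close> averaged out, reduces the claim to the pointwise supersolution inequality plus
  \<open>step_error\<close>.\<close>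

lemma damped_step:
  assumes st: "0 \<le> s" "s < t" and D: "D \<in> sets (natural_filtration M B s)"
    and R: "R \<in> borel_measurable (natural_filtration M B s)" "\<And>\<omega>. \<omega> \<in> space M \<Longrightarrow> R \<omega> > 0"
    and c: "c0 > 0" "c \<ge> c0" "0 \<le> \<theta>" "\<theta> * (t - s) / 2 \<le> c - c0"
  shows "expectation (\<lambda>\<omega>. indicator D \<omega> * damped \<theta> c (R \<omega> * exp (B t \<omega> - B s \<omega> - (t - s) / 2)))
    \<le> expectation (\<lambda>\<omega>. indicator D \<omega> * damped \<theta> (c - \<theta> * (t - s) / 2) (R \<omega>))
      + step_error (damped_bound (\<theta> / c0)) (t - s)"
proof -
  define \<delta> where "\<delta> = t - s"
  have \<delta>: "\<delta> > 0" using st by (simp add: \<delta>_def)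
  define K where "K = damped_bound (\<theta> / c0)"
  have K: "K \<ge> 0" using damped_bounds(1)[OF c(1-3), of 0] by (simp add: K_def)
  define b where "b \<omega> = B t \<omega> - B s \<omega>" for \<omega>
  define g where "g \<omega> = b \<omega> - \<delta> / 2" for \<omega>
  define y where "y \<omega> = ln (R \<omega>)" for \<omega>
  have Ry: "R \<omega> = exp (y \<omega>)" if "\<omega> \<in> space M" for \<omega> using R(2)[OF that] by (simp add: y_def)
  note F = subalgebra_natural_filtration[of s]
  have y[measurable]: "y \<in> borel_measurable (natural_filtration M B s)"
    unfolding y_def[abs_def] using R(1) by simp
  note [measurable] = D measurable_from_subalg[OF F y] measurable_from_subalg[OF F R(1)]
  have [measurable]: "D \<in> events" using D F by (auto simp: subalgebra_def)
  have [measurable]: "random_variable borel (B s)" "random_variable borel (B t)"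
    using random_variable_B st by auto
  have [measurable]: "random_variable borel b" unfolding b_def[abs_def] by measurable
  have [measurable]: "random_variable borel g" unfolding g_def[abs_def] by measurable
  note mom = increment_moments[OF st, folded b_def \<delta>_def]
  have g1: "integrable M g" "expectation g = - \<delta> / 2"
    using mom by (auto simp: g_def[abs_def] prob_space)
  have g2_eq: "(g \<omega>)\<^sup>2 = (b \<omega>)\<^sup>2 - \<delta> * b \<omega> + \<delta>\<^sup>2 / 4" for \<omega>
    by (simp add: g_def power2_eq_square algebra_simps)
  have g2: "integrable M (\<lambda>\<omega>. (g \<omega>)\<^sup>2)" "expectation (\<lambda>\<omega>. (g \<omega>)\<^sup>2) = \<delta> + \<delta>\<^sup>2 / 4"
    unfolding g2_eq using mom by (auto simp: prob_space)
  \<comment> \<open>The inequality \<open>(u + v) ^ 3 \<le> 4 * u ^ 3 + 4 * v ^ 3\<close> for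
    nonnegative arguments, with \<open>v = \<delta> / 2\<close>; the gap factors as
    \<open>3 * (u + v) * (u - v)\<^sup>2\<close>.\<close>
  have g3_le: "\<bar>g \<omega>\<bar> ^ 3 \<le> 4 * \<bar>b \<omega>\<bar> ^ 3 + \<delta> ^ 3 / 2" for \<omega>
  proof -
    have "\<bar>g \<omega>\<bar> \<le> \<bar>b \<omega>\<bar> + \<delta> / 2" using \<delta> by (auto simp: g_def)
    then have "\<bar>g \<omega>\<bar> ^ 3 \<le> (\<bar>b \<omega>\<bar> + \<delta> / 2) ^ 3" by (intro power_mono) auto
    also have "\<dots> \<le> 4 * \<bar>b \<omega>\<bar> ^ 3 + \<delta> ^ 3 / 2"
    proof -
      have "4 * u ^ 3 + 4 * v ^ 3 - (u + v) ^ 3 = 3 * (u + v) * (u - v)\<^sup>2" for u v :: real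
        by (simp add: power2_eq_square power3_eq_cube algebra_simps)
      moreover have "3 * (\<bar>b \<omega>\<bar> + \<delta> / 2) * (\<bar>b \<omega>\<bar> - \<delta> / 2)\<^sup>2 \<ge> 0" using \<delta> by auto
      ultimately have "4 * \<bar>b \<omega>\<bar> ^ 3 + 4 * (\<delta> / 2) ^ 3 - (\<bar>b \<omega>\<bar> + \<delta> / 2) ^ 3 \<ge> 0" by metis
      then show ?thesis by (simp add: power_divide)
    qed
    finally show ?thesis .
  qed
  have g3: "integrable M (\<lambda>\<omega>. \<bar>g \<omega>\<bar> ^ 3)"
    by (rule Bochner_Integration.integrable_bound[of _ "\<lambda>\<omega>. 4 * \<bar>b \<omega>\<bar> ^ 3 + \<delta> ^ 3 / 2"])
      (use mom g3_le in \<open>auto intro!: AE_I2 order_trans[OF g3_le]\<close>)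
  have g3': "expectation (\<lambda>\<omega>. \<bar>g \<omega>\<bar> ^ 3) \<le> 8 * sqrt \<delta> ^ 3 + \<delta> ^ 3 / 2"
  proof -
    have "expectation (\<lambda>\<omega>. \<bar>g \<omega>\<bar> ^ 3) \<le> expectation (\<lambda>\<omega>. 4 * \<bar>b \<omega>\<bar> ^ 3 + \<delta> ^ 3 / 2)"
      using g3 mom g3_le by (intro integral_mono) auto
    also have "\<dots> \<le> 8 * sqrt \<delta> ^ 3 + \<delta> ^ 3 / 2" using mom by (simp add: prob_space)
    finally show ?thesis .
  qed
  define F0 where "F0 \<omega> = indicator D \<omega> * damped \<theta> c (exp (y \<omega>))" for \<omega>
  define F1 where "F1 \<omega> = indicator D \<omega> * damped1 \<theta> c (y \<omega>)" for \<omega>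
  define F2 where "F2 \<omega> = indicator D \<omega> * damped2 \<theta> c (y \<omega>)" for \<omega>
  have bd: "\<bar>indicator D \<omega> * z\<bar> \<le> L" if "\<bar>z\<bar> \<le> L" for z L :: real and \<omega>
    using that by (auto simp: indicator_def)
  have bd': "indicator D \<omega> * z \<le> L" if "z \<le> L" "0 \<le> z" for z L :: real and \<omega>
    using that by (auto simp: indicator_def)
  have "c > 0" using c by simp
  note B12 = damped_bounds[OF c(1-3), folded K_def]
  have F0_int: "integrable M F0"
    by (rule integrable_const_bound[of _ "exp (\<theta> / c0)"])
      (auto simp: F0_def[abs_def] intro!: AE_I2 bd bd' damped_le c)
  have F1_int: "integrable M F1"
    by (rule integrable_const_bound[of _ K])
      (auto simp: F1_def[abs_def] intro!: AE_I2 bd bd' B12)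
  have F2_int: "integrable M F2"
    by (rule integrable_const_bound[of _ K])
      (auto simp: F2_def[abs_def] intro!: AE_I2 bd bd' B12)
  have F12_meas: "F1 \<in> borel_measurable (natural_filtration M B s)" "F2 \<in> borel_measurable (natural_filtration M B s)"
    unfolding F1_def[abs_def] F2_def[abs_def] by measurable
  \<comment> \<open>The coefficients are determined at time \<open>s\<close>, so expectations of
    their products with \<open>g\<close> and \<open>g\<^sup>2\<close> factor.\<close>
  have "indep_var borel F1 borel b" "indep_var borel F2 borel b"
    using indep_var_increment[OF st] F12_meas by (auto simp: b_def[abs_def])
  from indep_var_compose[OF this(1), of id borel "\<lambda>x. x - \<delta> / 2" borel]
    indep_var_compose[OF this(2), of id borel "\<lambda>x. (x - \<delta> / 2)\<^sup>2" borel]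
  have ind: "indep_var borel F1 borel g" "indep_var borel F2 borel (\<lambda>\<omega>. (g \<omega>)\<^sup>2)"
    by (auto simp: g_def[abs_def] comp_def)
  have E1: "integrable M (\<lambda>\<omega>. F1 \<omega> * g \<omega>)" "expectation (\<lambda>\<omega>. F1 \<omega> * g \<omega>) = expectation F1 * (- \<delta> / 2)"
    using indep_var_lebesgue_integral[OF ind(1) F1_int g1(1)] indep_var_integrable[OF ind(1) F1_int g1(1)] g1 by auto
  have E2: "integrable M (\<lambda>\<omega>. F2 \<omega> * (g \<omega>)\<^sup>2)" "expectation (\<lambda>\<omega>. F2 \<omega> * (g \<omega>)\<^sup>2) = expectation F2 * (\<delta> + \<delta>\<^sup>2 / 4)"
    using indep_var_lebesgue_integral[OF ind(2) F2_int g2(1)] indep_var_integrable[OF ind(2) F2_int g2(1)] g2 by auto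
  have F2_le: "expectation F2 \<le> K"
  proof -
    have "F2 \<omega> \<le> K" for \<omega> using bd[OF B12(2), of \<omega> "y \<omega>"] unfolding F2_def by linarith
    then have "expectation F2 \<le> expectation (\<lambda>_. K)" using F2_int by (intro integral_mono) auto
    then show ?thesis by (simp add: prob_space)
  qed
  have "expectation (\<lambda>\<omega>. indicator D \<omega> * damped \<theta> c (R \<omega> * exp (b \<omega> - \<delta> / 2)))
    \<le> expectation (\<lambda>\<omega>. F0 \<omega> + F1 \<omega> * g \<omega> + F2 \<omega> * (g \<omega>)\<^sup>2 / 2 + K / 6 * \<bar>g \<omega>\<bar> ^ 3)"
  proof (rule integral_mono)
    show "integrable M (\<lambda>\<omega>. indicator D \<omega> * damped \<theta> c (R \<omega> * exp (b \<omega> - \<delta> / 2)))"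
      by (rule integrable_const_bound[of _ "exp (\<theta> / c0)"])
        (auto intro!: AE_I2 bd bd' damped_le c mult_nonneg_nonneg less_imp_le[OF R(2)])
    show "integrable M (\<lambda>\<omega>. F0 \<omega> + F1 \<omega> * g \<omega> + F2 \<omega> * (g \<omega>)\<^sup>2 / 2 + K / 6 * \<bar>g \<omega>\<bar> ^ 3)"
      using F0_int E1 E2 g3 by auto
    fix \<omega> assume \<omega>: "\<omega> \<in> space M"
    have eq: "R \<omega> * exp (b \<omega> - \<delta> / 2) = exp (y \<omega> + g \<omega>)"
      by (simp add: Ry[OF \<omega>] g_def exp_add[symmetric])
    have "damped \<theta> c (exp (y \<omega> + g \<omega>)) \<le> damped \<theta> c (exp (y \<omega>)) + damped1 \<theta> c (y \<omega>) * g \<omega>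
        + damped2 \<theta> c (y \<omega>) * (g \<omega>)\<^sup>2 / 2 + K / 6 * \<bar>g \<omega>\<bar> ^ 3"
      using taylor_cubic_remainder[OF DERIV_damped[OF \<open>c > 0\<close>] B12(3), of "y \<omega>" "g \<omega>"] by linarith
    then show "indicator D \<omega> * damped \<theta> c (R \<omega> * exp (b \<omega> - \<delta> / 2)) \<le>
        F0 \<omega> + F1 \<omega> * g \<omega> + F2 \<omega> * (g \<omega>)\<^sup>2 / 2 + K / 6 * \<bar>g \<omega>\<bar> ^ 3"
      unfolding eq F0_def F1_def F2_def using K by (cases "\<omega> \<in> D") auto
  qed
  also have "\<dots> = expectation F0 + expectation F1 * (- \<delta> / 2) + expectation F2 * (\<delta> + \<delta>\<^sup>2 / 4) / 2
      + K / 6 * expectation (\<lambda>\<omega>. \<bar>g \<omega>\<bar> ^ 3)"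
    using F0_int E1 E2 g3 by simp
  \<comment> \<open>The mean \<open>- \<delta> / 2\<close> and the leading part
    \<open>\<delta>\<close> of the second moment combine into the generator in logarithmic
    coordinates; \<open>\<delta>\<^sup>2 / 8\<close> is half the excess of the second
    moment.\<close>
  also have "\<dots> = expectation F0 + \<delta> / 2 * (expectation F2 - expectation F1) + expectation F2 * (\<delta>\<^sup>2 / 8)
      + K / 6 * expectation (\<lambda>\<omega>. \<bar>g \<omega>\<bar> ^ 3)"
    by (simp add: field_simps)
  also have "\<dots> \<le> expectation F0 + \<delta> / 2 * (expectation F2 - expectation F1) + K * (\<delta>\<^sup>2 / 8)
      + K / 6 * (8 * sqrt \<delta> ^ 3 + \<delta> ^ 3 / 2)"
    using F2_le g3' K \<delta> by (intro add_mono mult_left_mono mult_right_mono) auto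
  also have "\<dots> \<le> expectation F0 + \<delta> / 2 * (expectation F2 - expectation F1) + step_error K \<delta>"
  proof -
    have "step_error K \<delta> - (K * (\<delta>\<^sup>2 / 8) + K / 6 * (8 * sqrt \<delta> ^ 3 + \<delta> ^ 3 / 2))
      = K * (7 / 8 * \<delta>\<^sup>2 + 2 / 3 * sqrt \<delta> ^ 3 + 11 / 12 * \<delta> ^ 3)"
      by (simp add: step_error_def field_simps)
    moreover have "\<dots> \<ge> 0" using K \<delta> by (intro mult_nonneg_nonneg add_nonneg_nonneg) auto
    ultimately show ?thesis by linarith
  qed
  \<comment> \<open>Reassembled into one expectation so that \<open>damped_supersolution\<close>
    applies pointwise. The lowered parameter is still at least \<open>c0\<close>, which keeps the
    right-hand side bounded.\<close>
  also have "expectation F0 + \<delta> / 2 * (expectation F2 - expectation F1)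
    = expectation (\<lambda>\<omega>. F0 \<omega> + \<delta> / 2 * (F2 \<omega> - F1 \<omega>))"
    using F0_int F1_int F2_int by simp
  also have "\<dots> \<le> expectation (\<lambda>\<omega>. indicator D \<omega> * damped \<theta> (c - \<theta> * \<delta> / 2) (R \<omega>))"
  proof (rule integral_mono)
    show "integrable M (\<lambda>\<omega>. F0 \<omega> + \<delta> / 2 * (F2 \<omega> - F1 \<omega>))"
      using F0_int F1_int F2_int by simp
    show "integrable M (\<lambda>\<omega>. indicator D \<omega> * damped \<theta> (c - \<theta> * \<delta> / 2) (R \<omega>))"
      by (rule integrable_const_bound[of _ "exp (\<theta> / c0)"])
        (use c in \<open>auto simp: \<delta>_def intro!: AE_I2 bd bd' damped_le less_imp_le[OF R(2)]\<close>)
    show "F0 \<omega> + \<delta> / 2 * (F2 \<omega> - F1 \<omega>) \<le> indicator D \<omega> * damped \<theta> (c - \<theta> * \<delta> / 2) (R \<omega>)"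
      if "\<omega> \<in> space M" for \<omega>
      using damped_supersolution[OF \<open>c > 0\<close> c(3), of \<delta> "y \<omega>"] \<delta> c
      by (auto simp: F0_def F1_def F2_def indicator_def Ry[OF that] \<delta>_def)
  qed
  finally show ?thesis by (simp add: K_def \<delta>_def b_def)
qed

subsection \<open>Passage to the limit\<close>

lemma exp_bm_pos [simp]: "exp_bm B t \<omega> > 0"
  by (simp add: exp_bm_def)

lemma continuous_exp_bm: "\<omega> \<in> space M \<Longrightarrow> 0 \<le> s \<Longrightarrow> continuous_on {s..t} (\<lambda>t. exp_bm B t \<omega>)"
  unfolding exp_bm_def
  by (intro continuous_intros continuous_on_subset[OF continuous_paths[of \<omega>]]) auto

lemma int_exp_bm_eq_integral:
  assumes "\<omega> \<in> space M"
  shows "int_exp_bm B t \<omega> = integral {0..t} (\<lambda>s. exp_bm B s \<omega>)"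
  unfolding int_exp_bm_def
  using continuous_exp_bm[OF assms, of 0 t]
  by (intro set_borel_integral_eq_integral borel_integrable_atLeastAtMost') auto

lemma int_exp_bm_split:
  assumes "\<omega> \<in> space M" "0 \<le> s" "s \<le> t"
  shows "int_exp_bm B t \<omega> = int_exp_bm B s \<omega> + integral {s..t} (\<lambda>u. exp_bm B u \<omega>)"
  unfolding int_exp_bm_eq_integral[OF assms(1)]
  using assms continuous_exp_bm[OF assms(1), of 0 t]
  by (intro Henstock_Kurzweil_Integration.integral_combine[symmetric] integrable_continuous_interval) auto

lemma int_exp_bm_pos:
  assumes "\<omega> \<in> space M" "t > 0"
  shows "int_exp_bm B t \<omega> > 0"
proof -
  note c = continuous_exp_bm[OF assms(1), of 0 t]
  obtain u where u: "u \<in> {0..t}" "\<And>v. v \<in> {0..t} \<Longrightarrow> exp_bm B u \<omega> \<le> exp_bm B v \<omega>"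
    using continuous_attains_inf[of "{0..t}" "\<lambda>t. exp_bm B t \<omega>"] c assms by auto
  have "0 < t * exp_bm B u \<omega>" using assms by simp
  also have "\<dots> = integral {0..t} (\<lambda>_. exp_bm B u \<omega>)" using assms by simp
  also have "\<dots> \<le> integral {0..t} (\<lambda>v. exp_bm B v \<omega>)"
    using u c by (intro integral_le integrable_continuous_interval) auto
  finally show ?thesis using assms by (simp add: int_exp_bm_eq_integral)
qed

lemma exp_bm_adapted: "0 \<le> s \<Longrightarrow> s \<le> t \<Longrightarrow> exp_bm B s \<in> borel_measurable (natural_filtration M B t)"
  unfolding exp_bm_def[abs_def] using B_adapted[of s t] by measurable

text \<open>On every path the integral is the limit of right Riemann sums whose nodes do not exceed
  \<open>t\<close>.\<close>

lemma int_exp_bm_adapted: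
  assumes "t > 0"
  shows "int_exp_bm B t \<in> borel_measurable (natural_filtration M B t)"
proof (rule borel_measurable_LIMSEQ_real)
  show "(\<lambda>n. \<Sum>i<n. (t - 0) / real n * exp_bm B (0 + real (Suc i) * ((t - 0) / real n)) \<omega>)
    \<longlonglongrightarrow> int_exp_bm B t \<omega>" if "\<omega> \<in> space (natural_filtration M B t)" for \<omega>
    using that assms right_riemann_sum_tendsto[OF assms continuous_exp_bm[of \<omega> 0 t]]
    by (simp add: int_exp_bm_eq_integral)
  show "(\<lambda>\<omega>. \<Sum>i<n. (t - 0) / real n * exp_bm B (0 + real (Suc i) * ((t - 0) / real n)) \<omega>)
    \<in> borel_measurable (natural_filtration M B t)" for n
  proof (intro borel_measurable_sum borel_measurable_times borel_measurable_const exp_bm_adapted)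
    fix i assume i: "i \<in> {..<n}"
    show "0 \<le> 0 + real (Suc i) * ((t - 0) / real n)" using assms by simp
    have "real (Suc i) * t \<le> real n * t" using i assms by (intro mult_right_mono) auto
    then show "0 + real (Suc i) * ((t - 0) / real n) \<le> t" using i by (simp add: field_simps)
  qed
qed

section \<open>The ratio and its discretization after time \<open>s\<close>\<close>

abbreviation ratio :: "real \<Rightarrow> 'a \<Rightarrow> real" where
  "ratio t \<omega> \<equiv> exp_bm B t \<omega> / int_exp_bm B t \<omega>"

lemma ratio_adapted: "t > 0 \<Longrightarrow> ratio t \<in> borel_measurable (natural_filtration M B t)"
  using exp_bm_adapted[of t t] int_exp_bm_adapted[of t] by measurable

lemma ratio_pos: "\<omega> \<in> space M \<Longrightarrow> t > 0 \<Longrightarrow> ratio t \<omega> > 0"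
  by (simp add: int_exp_bm_pos)

lemma random_variable_ratio: "t > 0 \<Longrightarrow> random_variable borel (ratio t)"
  using measurable_from_subalg[OF subalgebra_natural_filtration ratio_adapted] .

text \<open>The integral up to \<open>s\<close> is kept exact and only the part after
  \<open>s\<close> is discretized. Right endpoints put the newest value into both numerator and
  denominator, which gives the update an exact form in the reciprocal.\<close>

definition riemann_ratio :: "real \<Rightarrow> real \<Rightarrow> nat \<Rightarrow> 'a \<Rightarrow> real" where
  "riemann_ratio s \<delta> k \<omega> = exp_bm B (s + real k * \<delta>) \<omega> /
     (int_exp_bm B s \<omega> + (\<Sum>i<k. \<delta> * exp_bm B (s + real (Suc i) * \<delta>) \<omega>))"

lemma riemann_ratio_pos:
  assumes "\<omega> \<in> space M" "s > 0" "\<delta> > 0"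
  shows "riemann_ratio s \<delta> k \<omega> > 0"
  unfolding riemann_ratio_def using assms
  by (intro divide_pos_pos add_pos_nonneg sum_nonneg mult_nonneg_nonneg) (auto simp: int_exp_bm_pos less_imp_le)

lemma riemann_ratio_adapted:
  assumes "s > 0" "\<delta> > 0"
  shows "riemann_ratio s \<delta> k \<in> borel_measurable (natural_filtration M B (s + real k * \<delta>))"
  unfolding riemann_ratio_def[abs_def]
proof (intro borel_measurable_divide borel_measurable_add borel_measurable_sum borel_measurable_times
    borel_measurable_const exp_bm_adapted)
  have "sets (natural_filtration M B s) \<subseteq> sets (natural_filtration M B (s + real k * \<delta>))"
    using assms by (intro natural_filtration_mono) auto
  then show "int_exp_bm B s \<in> borel_measurable (natural_filtration M B (s + real k * \<delta>))"
    using int_exp_bm_adapted[OF assms(1)]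
    by (rule_tac measurable_from_subalg) (simp_all add: subalgebra_def)
  show "s + real (Suc i) * \<delta> \<le> s + real k * \<delta>" if "i \<in> {..<k}" for i
    using that assms by (intro add_left_mono mult_right_mono) auto
qed (use assms in auto)

text \<open>With the old denominator \<open>A\<close> and the new numerator \<open>m'\<close>, the
  reciprocal of the new ratio is \<open>A / m' + \<delta>\<close>. The extra \<open>\<delta>\<close>
  is absorbed into the damping parameter.\<close>

lemma damped_riemann_ratio_Suc:
  assumes "\<omega> \<in> space M" "s > 0" "\<delta> > 0" "c \<ge> 0"
  shows "damped \<theta> c (riemann_ratio s \<delta> (Suc k) \<omega>) = damped \<theta> (c + \<delta>)
    (riemann_ratio s \<delta> k \<omega> * exp (B (s + real (Suc k) * \<delta>) \<omega> - B (s + real k * \<delta>) \<omega> - \<delta> / 2))"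
proof -
  define m where "m = exp_bm B (s + real k * \<delta>) \<omega>"
  define m' where "m' = exp_bm B (s + real (Suc k) * \<delta>) \<omega>"
  define A where "A = int_exp_bm B s \<omega> + (\<Sum>i<k. \<delta> * exp_bm B (s + real (Suc i) * \<delta>) \<omega>)"
  have A: "A > 0" unfolding A_def using assms
    by (intro add_pos_nonneg sum_nonneg mult_nonneg_nonneg) (auto simp: int_exp_bm_pos less_imp_le)
  have m': "m' > 0" by (simp add: m'_def)
  have "m * exp (B (s + real (Suc k) * \<delta>) \<omega> - B (s + real k * \<delta>) \<omega> - \<delta> / 2) = m'"
    unfolding m_def m'_def exp_bm_def exp_add[symmetric] by (simp add: field_simps)
  then have "riemann_ratio s \<delta> k \<omega> * exp (B (s + real (Suc k) * \<delta>) \<omega> - B (s + real k * \<delta>) \<omega> - \<delta> / 2) = m' / A"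
    unfolding riemann_ratio_def m_def[symmetric] A_def[symmetric] by simp
  moreover have "riemann_ratio s \<delta> (Suc k) \<omega> = m' / (A + \<delta> * m')"
    by (simp add: riemann_ratio_def m'_def A_def)
  moreover have "(m' / (A + \<delta> * m')) / (1 + c * (m' / (A + \<delta> * m'))) = (m' / A) / (1 + (c + \<delta>) * (m' / A))"
  proof -
    have "A + \<delta> * m' > 0" "A + (c + \<delta>) * m' > 0"
      using A m' assms by (auto intro!: add_pos_nonneg)
    moreover from this have "1 + c * (m' / (A + \<delta> * m')) = (A + (c + \<delta>) * m') / (A + \<delta> * m')"
      by (simp add: field_simps)
    moreover have "1 + (c + \<delta>) * (m' / A) = (A + (c + \<delta>) * m') / A"
      using A by (simp add: field_simps)
    ultimately show ?thesis using A by simp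
  qed
  moreover have "damped \<theta> u x = exp (\<theta> * (x / (1 + u * x)))" for u x
    by (simp add: damped_def)
  ultimately show ?thesis by (simp only:)
qed

lemma riemann_ratio_tendsto:
  assumes "\<omega> \<in> space M" "0 < s" "s < t"
  shows "(\<lambda>n. riemann_ratio s ((t - s) / real n) n \<omega>) \<longlonglongrightarrow> ratio t \<omega>"
proof -
  have "(\<lambda>n. exp_bm B t \<omega> / (int_exp_bm B s \<omega> + (\<Sum>i<n. (t - s) / real n * exp_bm B (s + real (Suc i) * ((t - s) / real n)) \<omega>)))
    \<longlonglongrightarrow> exp_bm B t \<omega> / (int_exp_bm B s \<omega> + integral {s..t} (\<lambda>u. exp_bm B u \<omega>))"
    using assms int_exp_bm_split[OF assms(1), of s t] int_exp_bm_pos[OF assms(1), of t]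
    by (intro tendsto_intros right_riemann_sum_tendsto continuous_exp_bm) auto
  then have "(\<lambda>n. exp_bm B t \<omega> / (int_exp_bm B s \<omega> + (\<Sum>i<n. (t - s) / real n * exp_bm B (s + real (Suc i) * ((t - s) / real n)) \<omega>)))
    \<longlonglongrightarrow> ratio t \<omega>"
    using assms by (subst int_exp_bm_split[of \<omega> s t]) auto
  then show ?thesis
  proof (rule Lim_transform_eventually)
    \<comment> \<open>For \<open>n > 0\<close> the last node is \<open>t\<close>; at
      \<open>n = 0\<close> division by zero gives step 0, and the numerator would be taken at
      \<open>s\<close>.\<close>
    show "\<forall>\<^sub>F n in sequentially. exp_bm B t \<omega> / (int_exp_bm B s \<omega> + (\<Sum>i<n. (t - s) / real n * exp_bm B (s + real (Suc i) * ((t - s) / real n)) \<omega>))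
      = riemann_ratio s ((t - s) / real n) n \<omega>"
      using eventually_gt_at_top[of 0] by eventually_elim (simp add: riemann_ratio_def)
  qed
qed

text \<open>Each step backwards raises the parameter by \<open>\<delta>\<close> through the
  recursion and lowers it by \<open>\<theta> * \<delta> / 2\<close> through
  \<open>damped_step\<close>. The net gain \<open>(1 - \<theta> / 2) * \<delta>\<close> is why
  \<open>c k\<close> counts the remaining steps, ending with \<open>c n = c0\<close>.\<close>

lemma damped_riemann_ratio_le:
  assumes s: "0 < s" and \<delta>: "\<delta> > 0" and D: "D \<in> sets (natural_filtration M B s)"
    and c: "c0 > 0" and \<theta>: "0 \<le> \<theta>" "\<theta> < 2" and "k \<le> n"
  defines "c \<equiv> \<lambda>k. c0 + real (n - k) * ((1 - \<theta> / 2) * \<delta>)"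
  shows "expectation (\<lambda>\<omega>. indicator D \<omega> * damped \<theta> (c k) (riemann_ratio s \<delta> k \<omega>))
    \<le> expectation (\<lambda>\<omega>. indicator D \<omega> * damped \<theta> (c 0) (ratio s \<omega>))
      + real k * step_error (damped_bound (\<theta> / c0)) \<delta>"
  using \<open>k \<le> n\<close>
proof (induction k)
  case 0
  then show ?case by (simp add: riemann_ratio_def)
next
  case (Suc k)
  have c_Suc: "c k = c (Suc k) + (1 - \<theta> / 2) * \<delta>"
  proof -
    have "real (n - k) = real (n - Suc k) + 1" using Suc.prems by (simp add: of_nat_diff)
    then show ?thesis unfolding c_def by (simp only: distrib_right)
  qed
  have c_ge: "c (Suc k) \<ge> c0"
    using \<theta> \<delta> by (simp add: c_def)
  define u where "u = s + real k * \<delta>"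
  have Suc_u: "s + real (Suc k) * \<delta> = u + \<delta>" by (simp add: u_def algebra_simps)
  have u: "s \<le> u" using \<delta> by (simp add: u_def)
  have "D \<in> sets (natural_filtration M B u)" using D natural_filtration_mono[OF u] by blast
  moreover have "riemann_ratio s \<delta> k \<in> borel_measurable (natural_filtration M B u)"
    unfolding u_def using s \<delta> by (rule riemann_ratio_adapted)
  \<comment> \<open>Because \<open>\<theta> < 2\<close>, the loss
    \<open>\<theta> * \<delta> / 2\<close> is at most the gain \<open>\<delta>\<close>, so the
    parameter never falls below \<open>c0\<close>.\<close>
  moreover have "\<theta> * ((u + \<delta>) - u) / 2 \<le> c (Suc k) + \<delta> - c0"
  proof -
    have "\<theta> * \<delta> \<le> 2 * \<delta>" using \<theta> \<delta> by (intro mult_right_mono) auto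
    then show ?thesis unfolding add_diff_cancel_left' using c_ge by linarith
  qed
  ultimately have "expectation (\<lambda>\<omega>. indicator D \<omega> * damped \<theta> (c (Suc k) + \<delta>) (riemann_ratio s \<delta> k \<omega> * exp (B (u + \<delta>) \<omega> - B u \<omega> - ((u + \<delta>) - u) / 2)))
    \<le> expectation (\<lambda>\<omega>. indicator D \<omega> * damped \<theta> (c (Suc k) + \<delta> - \<theta> * ((u + \<delta>) - u) / 2) (riemann_ratio s \<delta> k \<omega>))
      + step_error (damped_bound (\<theta> / c0)) ((u + \<delta>) - u)"
    using s u \<delta> c c_ge \<theta> by (intro damped_step) (auto intro!: riemann_ratio_pos)
  moreover have "expectation (\<lambda>\<omega>. indicator D \<omega> * damped \<theta> (c (Suc k)) (riemann_ratio s \<delta> (Suc k) \<omega>))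
    = expectation (\<lambda>\<omega>. indicator D \<omega> * damped \<theta> (c (Suc k) + \<delta>) (riemann_ratio s \<delta> k \<omega> * exp (B (u + \<delta>) \<omega> - B u \<omega> - ((u + \<delta>) - u) / 2)))"
    using s \<delta> c c_ge
    by (intro Bochner_Integration.integral_cong refl) (simp add: damped_riemann_ratio_Suc Suc_u u_def[symmetric] del: of_nat_Suc)
  moreover have "c (Suc k) + \<delta> - \<theta> * ((u + \<delta>) - u) / 2 = c k"
    by (simp add: c_Suc algebra_simps)
  ultimately have "expectation (\<lambda>\<omega>. indicator D \<omega> * damped \<theta> (c (Suc k)) (riemann_ratio s \<delta> (Suc k) \<omega>))
    \<le> expectation (\<lambda>\<omega>. indicator D \<omega> * damped \<theta> (c k) (riemann_ratio s \<delta> k \<omega>)) + step_error (damped_bound (\<theta> / c0)) \<delta>"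
    by simp
  with Suc show ?case by (simp add: algebra_simps)
qed

text \<open>The discrete bound over all \<open>n\<close> steps of length \<open>(t - s) / n\<close>,
  in the limit: the left side converges by dominated convergence and the accumulated error
  vanishes.\<close>

lemma damped_ratio_le:
  assumes s: "0 < s" "s < t" and D: "D \<in> sets (natural_filtration M B s)"
    and c: "c0 > 0" and \<theta>: "0 \<le> \<theta>" "\<theta> < 2"
  shows "expectation (\<lambda>\<omega>. indicator D \<omega> * damped \<theta> c0 (ratio t \<omega>))
    \<le> expectation (\<lambda>\<omega>. indicator D \<omega> * damped \<theta> (c0 + (1 - \<theta> / 2) * (t - s)) (ratio s \<omega>))"
proof (rule LIMSEQ_le)
  have Dm [measurable]: "D \<in> events"
    using D subalgebra_natural_filtration[of s] by (auto simp: subalgebra_def)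
  have [measurable]: "random_variable borel (ratio t)"
    using random_variable_ratio s by auto
  have rm: "random_variable borel (riemann_ratio s ((t - s) / real n) n)" if "n > 0" for n
    using measurable_from_subalg[OF subalgebra_natural_filtration riemann_ratio_adapted[of s "(t - s) / real n" n]]
      s that by auto
  \<comment> \<open>Indexing by \<open>Suc n\<close> avoids step 0, for which positivity and
    adaptedness of the discretized ratio were not established.\<close>
  have "(\<lambda>n. expectation (\<lambda>\<omega>. indicator D \<omega> * damped \<theta> c0 (riemann_ratio s ((t - s) / real (Suc n)) (Suc n) \<omega>)))
    \<longlonglongrightarrow> expectation (\<lambda>\<omega>. indicator D \<omega> * damped \<theta> c0 (ratio t \<omega>))"
  proof (rule integral_dominated_convergence[where w = "\<lambda>_. exp (\<theta> / c0)"])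
    show "AE \<omega> in M. (\<lambda>n. indicator D \<omega> * damped \<theta> c0 (riemann_ratio s ((t - s) / real (Suc n)) (Suc n) \<omega>))
        \<longlonglongrightarrow> indicator D \<omega> * damped \<theta> c0 (ratio t \<omega>)"
    proof (rule AE_I2)
      fix \<omega> assume \<omega>: "\<omega> \<in> space M"
      have "1 + c0 * ratio t \<omega> > 0" using ratio_pos[OF \<omega>, of t] s c
        by (intro add_pos_nonneg mult_nonneg_nonneg) (auto simp del: times_divide_eq_right)
      then show "(\<lambda>n. indicator D \<omega> * damped \<theta> c0 (riemann_ratio s ((t - s) / real (Suc n)) (Suc n) \<omega>))
        \<longlonglongrightarrow> indicator D \<omega> * damped \<theta> c0 (ratio t \<omega>)"
        unfolding damped_def
        by (intro tendsto_intros LIMSEQ_Suc[OF riemann_ratio_tendsto] \<omega> s) auto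
    qed
    show "AE \<omega> in M. norm (indicator D \<omega> * damped \<theta> c0 (riemann_ratio s ((t - s) / real (Suc n)) (Suc n) \<omega>)) \<le> exp (\<theta> / c0)" for n
    proof (rule AE_I2)
      fix \<omega> assume "\<omega> \<in> space M"
      then have "riemann_ratio s ((t - s) / real (Suc n)) (Suc n) \<omega> > 0"
        using s by (intro riemann_ratio_pos) auto
      from damped_le[OF c order_refl \<theta>(1) less_imp_le[OF this]]
      show "norm (indicator D \<omega> * damped \<theta> c0 (riemann_ratio s ((t - s) / real (Suc n)) (Suc n) \<omega>)) \<le> exp (\<theta> / c0)"
        by (auto simp: indicator_def)
    qed
    have [measurable]: "random_variable borel (riemann_ratio s ((t - s) / real (Suc n)) (Suc n))" for n
      using rm[of "Suc n"] by simp
    show "(\<lambda>\<omega>. indicator D \<omega> * damped \<theta> c0 (riemann_ratio s ((t - s) / real (Suc n)) (Suc n) \<omega>)) \<in> borel_measurable M" for n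
      by measurable
    show "(\<lambda>\<omega>. indicator D \<omega> * damped \<theta> c0 (ratio t \<omega>)) \<in> borel_measurable M"
      by measurable
  qed auto
  then show "(\<lambda>n. expectation (\<lambda>\<omega>. indicator D \<omega> * damped \<theta> c0 (riemann_ratio s ((t - s) / real n) n \<omega>)))
    \<longlonglongrightarrow> expectation (\<lambda>\<omega>. indicator D \<omega> * damped \<theta> c0 (ratio t \<omega>))"
    by (rule LIMSEQ_imp_Suc)
  let ?E = "expectation (\<lambda>\<omega>. indicator D \<omega> * damped \<theta> (c0 + (1 - \<theta> / 2) * (t - s)) (ratio s \<omega>))"
  show "(\<lambda>n. ?E + real n * step_error (damped_bound (\<theta> / c0)) ((t - s) / real n)) \<longlonglongrightarrow> ?E"
    using tendsto_add[OF tendsto_const[of ?E] step_error_tendsto[of "t - s" "damped_bound (\<theta> / c0)"]] s by simp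
  show "\<exists>N. \<forall>n\<ge>N. expectation (\<lambda>\<omega>. indicator D \<omega> * damped \<theta> c0 (riemann_ratio s ((t - s) / real n) n \<omega>))
    \<le> ?E + real n * step_error (damped_bound (\<theta> / c0)) ((t - s) / real n)"
  proof (intro exI[of _ 1] allI impI)
    fix n :: nat assume "n \<ge> 1"
    then show "expectation (\<lambda>\<omega>. indicator D \<omega> * damped \<theta> c0 (riemann_ratio s ((t - s) / real n) n \<omega>))
      \<le> ?E + real n * step_error (damped_bound (\<theta> / c0)) ((t - s) / real n)"
      using damped_riemann_ratio_le[OF s(1) _ D c \<theta> order_refl, of "(t - s) / real n" n] s
      by simp
  qed
qed

section \<open>Removal of the damping at the later time\<close>

lemma exp_ratio_eq: "exp_ratio B \<theta> t \<omega> = damped \<theta> 0 (ratio t \<omega>)"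
  by (simp add: exp_ratio_def damped_def)

lemma integrable_damped_ratio:
  assumes "c > 0" "\<theta> \<ge> 0" "t > 0" and [measurable]: "D \<in> events"
  shows "integrable M (\<lambda>\<omega>. indicator D \<omega> * damped \<theta> c (ratio t \<omega>))"
  by (rule integrable_const_bound[of _ "exp (\<theta> / c)"])
    (use assms random_variable_ratio[of t] ratio_pos[of _ t] in
      \<open>auto intro!: AE_I2 damped_le simp: indicator_def less_imp_le\<close>)

text \<open>Monotone convergence as the damping at time \<open>t\<close> decreases to 0. The bound
  at time \<open>s\<close> retains the positive parameter
  \<open>(1 - \<theta> / 2) * (t - s)\<close>, hence is finite, and so yields integrability of the
  undamped exponential.\<close>

lemma exp_ratio_le:
  assumes s: "0 < s" "s < t" and D: "D \<in> sets (natural_filtration M B s)" and \<theta>: "0 \<le> \<theta>" "\<theta> < 2"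
  shows "integrable M (\<lambda>\<omega>. indicator D \<omega> * exp_ratio B \<theta> t \<omega>)" (is ?int)
    and "expectation (\<lambda>\<omega>. indicator D \<omega> * exp_ratio B \<theta> t \<omega>)
      \<le> expectation (\<lambda>\<omega>. indicator D \<omega> * damped \<theta> ((1 - \<theta> / 2) * (t - s)) (ratio s \<omega>))" (is "?lhs \<le> ?rhs")
proof -
  have [measurable]: "D \<in> events"
    using D subalgebra_natural_filtration[of s] by (auto simp: subalgebra_def)
  have [measurable]: "random_variable borel (ratio t)" "random_variable borel (ratio s)"
    using random_variable_ratio s by auto
  have pos: "ratio t \<omega> > 0" "ratio s \<omega> > 0" if "\<omega> \<in> space M" for \<omega>
    using ratio_pos[OF that] s by auto
  define f where "f n \<omega> = indicator D \<omega> * damped \<theta> (1 / real (Suc n)) (ratio t \<omega>)" for n \<omega>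
  have f_int: "integrable M (f n)" for n
    unfolding f_def[abs_def] using s \<theta> by (intro integrable_damped_ratio) auto
  have f_le: "expectation (f n) \<le> ?rhs" for n
  proof -
    have k: "(1 - \<theta> / 2) * (t - s) > 0" using \<theta> s by simp
    have "expectation (f n) \<le> expectation (\<lambda>\<omega>. indicator D \<omega> * damped \<theta> (1 / real (Suc n) + (1 - \<theta> / 2) * (t - s)) (ratio s \<omega>))"
      unfolding f_def[abs_def] by (intro damped_ratio_le assms) auto
    \<comment> \<open>Dropping \<open>1 / real (Suc n)\<close> from the parameter makes the bound
      independent of \<open>n\<close>.\<close>
    also have "\<dots> \<le> ?rhs"
      using k s by (intro integral_mono integrable_damped_ratio add_pos_pos mult_left_mono damped_antimono \<theta>)
        (auto simp: less_imp_le pos)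
    finally show ?thesis .
  qed
  have mono: "f m \<omega> \<le> f n \<omega>" if "m \<le> n" "\<omega> \<in> space M" for m n \<omega>
    unfolding f_def using that \<theta>
    by (intro mult_left_mono damped_antimono divide_left_mono) (auto simp: less_imp_le pos)
  have "incseq (\<lambda>n. expectation (f n))"
    using mono by (auto simp: incseq_def intro!: integral_mono f_int)
  then obtain L where L: "(\<lambda>n. expectation (f n)) \<longlonglongrightarrow> L"
    using incseq_convergent[of "\<lambda>n. expectation (f n)" ?rhs] f_le by blast
  have AE_mono: "AE \<omega> in M. mono (\<lambda>n. f n \<omega>)"
    using mono by (auto simp: mono_def)
  have AE_lim: "AE \<omega> in M. (\<lambda>n. f n \<omega>) \<longlonglongrightarrow> indicator D \<omega> * exp_ratio B \<theta> t \<omega>"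
    unfolding f_def exp_ratio_eq damped_def
    by (intro AE_I2 tendsto_intros LIMSEQ_Suc[OF lim_1_over_n]) auto
  have [measurable]: "exp_ratio B \<theta> t \<in> borel_measurable M"
    unfolding exp_ratio_eq[abs_def] by measurable
  have meas: "(\<lambda>\<omega>. indicator D \<omega> * exp_ratio B \<theta> t \<omega>) \<in> borel_measurable M" by measurable
  show ?int
    by (rule integrable_monotone_convergence[OF f_int AE_mono AE_lim L meas])
  have "?lhs = L"
    by (rule integral_monotone_convergence[OF f_int AE_mono AE_lim L meas])
  also have "L \<le> ?rhs" using f_le by (intro LIMSEQ_le_const2[OF L]) auto
  finally show "?lhs \<le> ?rhs" .
qed

end

section \<open>Integrability, supermartingale property and strict decrease\<close>

theorem theorem6p2:
  fixes P :: "'a measure" and B :: "real \<Rightarrow> 'a \<Rightarrow> real" and \<theta> t\<^sub>0 :: real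
  assumes "brownian_motion P B"
    and "\<theta> < 2" and "t\<^sub>0 > 0"
  shows "(\<theta> \<ge> 0 \<longrightarrow> supermartingale P (natural_filtration P B) {t\<^sub>0..} (exp_ratio B \<theta>))
    \<and> (\<forall>t\<ge>t\<^sub>0. integrable P (exp_ratio B \<theta> t))
    \<and> (\<theta> > 0 \<longrightarrow> strict_antimono_on {t\<^sub>0..} (\<lambda>t. integral\<^sup>L P (exp_ratio B \<theta> t)))"
proof (intro conjI impI allI)
  interpret brownian_motion P B by fact
  have adapted: "exp_ratio B \<theta> t \<in> borel_measurable (natural_filtration P B t)" if "t > 0" for t
    unfolding exp_ratio_eq[abs_def] using ratio_adapted[OF that] by measurable
  have rv [measurable]: "exp_ratio B \<theta> t \<in> borel_measurable P" if "t > 0" for t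
    using measurable_from_subalg[OF subalgebra_natural_filtration adapted[OF that]] .
  have space: "space P \<in> sets (natural_filtration P B s)" for s
    using sets.top[of "natural_filtration P B s"] by simp
  have drop_indicator: "expectation (\<lambda>\<omega>. indicator (space P) \<omega> * f \<omega>) = expectation f" for f :: "'a \<Rightarrow> real"
    by (intro Bochner_Integration.integral_cong) auto
  have int: "integrable P (exp_ratio B \<theta> t)" if "t > 0" for t
  proof (cases "\<theta> \<ge> 0")
    case True
    \<comment> \<open>Any earlier positive time would do; \<open>t / 2\<close> is taken, with the
      whole space as event.\<close>
    have "integrable P (\<lambda>\<omega>. indicator (space P) \<omega> * exp_ratio B \<theta> t \<omega>)"
      using exp_ratio_le(1)[of "t / 2" t "space P" \<theta>] that True assms(2) space by auto
    then show ?thesis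
      by (rule Bochner_Integration.integrable_cong[THEN iffD1, rotated -1]) auto
  next
    case False
    \<comment> \<open>For negative \<open>\<theta>\<close> the exponent is nonpositive.\<close>
    have "\<bar>exp_ratio B \<theta> t \<omega>\<bar> \<le> 1" if "\<omega> \<in> space P" for \<omega>
      using ratio_pos[OF that \<open>t > 0\<close>] False
        mult_nonpos_nonneg[of \<theta> "ratio t \<omega>"] by (simp add: exp_ratio_def)
    then show ?thesis
      using rv[OF that] by (intro integrable_const_bound[of _ 1]) auto
  qed
  then show "integrable P (exp_ratio B \<theta> t)" if "t \<ge> t\<^sub>0" for t using that assms by auto
  show "supermartingale P (natural_filtration P B) {t\<^sub>0..} (exp_ratio B \<theta>)" if \<theta>: "\<theta> \<ge> 0"
  proof (intro supermartingale.intro supermartingale_axioms.intro)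
    show "prob_space P" by (rule prob_space_axioms)
    show "filtration (space P) (natural_filtration P B)" by (rule filtration_natural_filtration)
    show "subalgebra P (natural_filtration P B t)" for t by (rule subalgebra_natural_filtration)
    show "exp_ratio B \<theta> t \<in> borel_measurable (natural_filtration P B t)" if "t \<in> {t\<^sub>0..}" for t
      using adapted that assms by auto
    show "integrable P (exp_ratio B \<theta> t)" if "t \<in> {t\<^sub>0..}" for t
      using int that assms by auto
    fix s t assume "s \<in> {t\<^sub>0..}" "t \<in> {t\<^sub>0..}" "s \<le> t"
    then have s: "0 < s" "s \<le> t" and t: "0 < t" using assms by auto
    interpret sub: finite_measure_subalgebra P "natural_filtration P B s"
      by standard (rule subalgebra_natural_filtration)
    let ?C = "real_cond_exp P (natural_filtration P B s) (exp_ratio B \<theta> t)"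
    let ?X = "exp_ratio B \<theta> s"
    have C: "?C \<in> borel_measurable (natural_filtration P B s)" by simp
    have C_int: "integrable P ?C" using int[OF t] by (rule sub.real_cond_exp_int)
    \<comment> \<open>The exceptional set, which belongs to the sigma-algebra at time
      \<open>s\<close>. Comparing integrals over it shows that it is null.\<close>
    define D where "D = {\<omega> \<in> space P. ?X \<omega> < ?C \<omega>}"
    have D: "D \<in> sets (natural_filtration P B s)"
      using borel_measurable_less[OF adapted[OF s(1)] C] by (simp add: D_def)
    then have Dm: "D \<in> events" using sub.subalg by (auto simp: subalgebra_def)
    have "expectation (\<lambda>\<omega>. indicator D \<omega> * exp_ratio B \<theta> t \<omega>) \<le> expectation (\<lambda>\<omega>. indicator D \<omega> * ?X \<omega>)"
    proof (cases "s = t")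
      case False
      then have st: "s < t" using s by simp
      have "expectation (\<lambda>\<omega>. indicator D \<omega> * exp_ratio B \<theta> t \<omega>)
          \<le> expectation (\<lambda>\<omega>. indicator D \<omega> * damped \<theta> ((1 - \<theta> / 2) * (t - s)) (ratio s \<omega>))"
        by (rule exp_ratio_le(2)[OF s(1) st D \<theta> assms(2)])
      also have "\<dots> \<le> expectation (\<lambda>\<omega>. indicator D \<omega> * ?X \<omega>)"
        unfolding exp_ratio_eq
      proof (rule integral_mono)
        show "integrable P (\<lambda>\<omega>. indicator D \<omega> * damped \<theta> ((1 - \<theta> / 2) * (t - s)) (ratio s \<omega>))"
          using st s assms(2) by (intro integrable_damped_ratio \<theta> Dm) auto
        show "integrable P (\<lambda>\<omega>. indicator D \<omega> * damped \<theta> 0 (ratio s \<omega>))"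
          using integrable_mult_indicator[OF Dm int[OF s(1)]] by (simp add: exp_ratio_eq)
        show "indicator D \<omega> * damped \<theta> ((1 - \<theta> / 2) * (t - s)) (ratio s \<omega>)
            \<le> indicator D \<omega> * damped \<theta> 0 (ratio s \<omega>)" if "\<omega> \<in> space P" for \<omega>
          using st assms(2) \<theta> less_imp_le[OF ratio_pos[OF that s(1)]]
          by (intro mult_left_mono damped_antimono) auto
      qed
      finally show ?thesis .
    qed simp
    moreover have "expectation (\<lambda>\<omega>. indicator D \<omega> * exp_ratio B \<theta> t \<omega>) = expectation (\<lambda>\<omega>. indicator D \<omega> * ?C \<omega>)"
      using sub.real_cond_exp_intA[OF int[OF t] D] by (simp add: set_lebesgue_integral_def)
    ultimately have "expectation (\<lambda>\<omega>. indicator D \<omega> * ?C \<omega>) \<le> expectation (\<lambda>\<omega>. indicator D \<omega> * ?X \<omega>)" by simp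
    moreover have int_D: "integrable P (\<lambda>\<omega>. indicator D \<omega> * ?C \<omega>)" "integrable P (\<lambda>\<omega>. indicator D \<omega> * ?X \<omega>)"
      using integrable_mult_indicator[OF Dm C_int] integrable_mult_indicator[OF Dm int[OF s(1)]] by auto
    \<comment> \<open>If \<open>D\<close> had positive measure, the strict inequality on it would
      make the integral of \<open>?C\<close> over \<open>D\<close> strictly larger than that of
      \<open>?X\<close>.\<close>
    ultimately have "emeasure P D = 0"
      using integral_less_AE[OF int_D(2,1) _ Dm]
      by (auto simp: D_def indicator_def intro!: ccontr[of "emeasure P D = 0"])
    then have "AE \<omega> in P. \<omega> \<notin> D" using Dm by (intro AE_not_in) (auto simp: null_sets_def)
    then show "AE \<omega> in P. ?C \<omega> \<le> ?X \<omega>"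
      by (rule AE_mp) (auto simp: D_def intro!: AE_I2)
  qed
  show "strict_antimono_on {t\<^sub>0..} (\<lambda>t. expectation (exp_ratio B \<theta> t))" if \<theta>: "\<theta> > 0"
  proof (rule monotone_onI)
    fix s t assume "s \<in> {t\<^sub>0..}" "t \<in> {t\<^sub>0..}" "s < t"
    then have s: "0 < s" "s < t" using assms by auto
    define k where "k = (1 - \<theta> / 2) * (t - s)"
    have k: "k > 0" using s assms by (simp add: k_def)
    have "expectation (exp_ratio B \<theta> t) \<le> expectation (\<lambda>\<omega>. damped \<theta> k (ratio s \<omega>))"
      using exp_ratio_le(2)[OF s space less_imp_le[OF \<theta>] assms(2)] by (simp add: drop_indicator k_def)
    \<comment> \<open>Strictness comes from the damping left at time \<open>s\<close>:
      \<open>k\<close> and the ratio are positive, so the integrands differ strictly at every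
      point.\<close>
    also have "\<dots> < expectation (exp_ratio B \<theta> s)"
    proof (rule integral_less_AE_space)
      have "integrable P (\<lambda>\<omega>. indicator (space P) \<omega> * damped \<theta> k (ratio s \<omega>))"
        using \<theta> k s by (intro integrable_damped_ratio) auto
      then show "integrable P (\<lambda>\<omega>. damped \<theta> k (ratio s \<omega>))"
        by (rule Bochner_Integration.integrable_cong[THEN iffD1, rotated -1]) auto
      show "AE \<omega> in P. damped \<theta> k (ratio s \<omega>) < exp_ratio B \<theta> s \<omega>"
      proof (rule AE_I2)
        fix \<omega> assume "\<omega> \<in> space P"
        then have r: "ratio s \<omega> > 0" using s by (intro ratio_pos)
        then show "damped \<theta> k (ratio s \<omega>) < exp_ratio B \<theta> s \<omega>"
          unfolding exp_ratio_eq by (rule damped_less[OF k \<theta>])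
      qed
    qed (use int s in \<open>auto simp: emeasure_space_1\<close>)
    finally show "expectation (exp_ratio B \<theta> t) < expectation (exp_ratio B \<theta> s)" .
  qed
qed

end
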